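(* Let $\alpha\in(0,1)$, $\beta\in(0,1-\alpha)$ and $R>0$ be fixed, let $J=\{1,2,3,\dots\}$, and let $Z_j=b_j\theta_j+\sigma\epsilon_j$, $j\in J$, with $(\epsilon_j)$ i.i.d. standard normal and $b_j>0$. Let $a=(a_k)_{k\ge1}$ be a positive monotone non-decreasing sequence and $\mathcal{E}_{a,2}(R)=\{x\in l_2(J):\sum_{j\in J}a_j^2x_j^2\le R^2\}$. In each of the four cases below (with $s,t,r,\gamma,\nu>0$ fixed) there exist positive constants $C_1(\alpha,\beta),C_2(\alpha,\beta)$, independent of $\sigma$, such that for all $0<\sigma<1$, $$C_1(\alpha,\beta) f(\sigma)\le\rho_2^2(\mathcal{E}_{a,2}(R),\alpha,\beta)\le C_2(\alpha,\beta) f(\sigma),$$ where: (i) if $a_k\sim k^s$ and $b_k\sim k^{-t}$: $f(\sigma)=\sigma^{\frac{4s}{2s+2t+1/2}}$; (ii) if $a_k\sim k^s$ and $b_k\sim\exp(-\gamma k^r)$: $f(\sigma)=\bigl(\log(\sigma^{-2})\bigr)^{-2s/r}$; (iii) if $a_k\sim\exp(\nu k^s)$ and $b_k\sim k^{-t}$: $f(\sigma)=\sigma^2\bigl(\log(\sigma^{-2})\bigr)^{(2t+1/2)/s}$; (iv) if $a_k\sim\exp(\nu k^s)$ with $s\le1$ and $b_k\sim\exp(-\gamma k^r)$: $f(\sigma)=e^{-2\nu\tilde D^s}$, where $\tilde D$ denotes the integer part of the solution of $\rho_D^2=R^2a_D^{-2}$, with $\rho_D^2=c(\alpha,\beta)\,\sigma^2\bigl(\sum_{j=1}^Db_j^{-4}\bigr)^{1/2}$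 and $c(\alpha,\beta)=\bigl(2\ln(1+4(1-\alpha-\beta)^2)\bigr)^{1/2}$.
   Context: For positive sequences, $v_k\sim w_k$ means that there exist positive constants $c_1,c_2$ with $c_1w_k\le v_k\le c_2w_k$ for all $k\ge1$. Observing $(Z_j)$ is equivalent to observing $Y_j=b_j^{-1}Z_j=\theta_j+\sigma_j\epsilon_j$ with $\sigma_j=\sigma b_j^{-1}$. $\mathbb{P}_\theta$ is the distribution of $Y=(Y_j)_{j\in J}$, and $\|\theta\|_2^2=\sum_j\theta_j^2$. A test is a measurable function $\Phi$ of $Y$ with values in $\{0,1\}$; the null hypothesis "$\theta=0$" is rejected iff $\Phi=1$. It has level $\alpha$ if $\mathbb{P}_0(\Phi=1)\le\alpha$. For $\mathcal{F}\subset l_2(J)$ and a level-$\alpha$ test $\Phi_\alpha$, $\rho_2(\Phi_\alpha,\mathcal{F},\beta)=\inf\{\rho>0:\ \inf_{\theta\in\mathcal{F},\|\theta\|_2\ge\rho}\mathbb{P}_\theta(\Phi_\alpha=1)>1-\beta\}$, and the $(\alpha,\beta)$ minimax rate of testing with respect to the $l_2$ norm, $\rho_2(\mathcal{F},\alpha,\beta)$, is the infimum of $\rho_2(\Phi_\alpha,\mathcal{F},\beta)$ over all level-$\alpha$ tests.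
   Formalization: The lower bound in (ii) and the upper bound in (iii) are proved for 0<σ≤σ₀, for every σ₀<1, with a constant depending on σ₀, since both fail as σ→1; in (iv) the equation is solved after linear interpolation in D, and the integer part may be 0. *)

theory Defs
  imports "HOL-Probability.Probability"
begin

abbreviation J :: "nat set" where
  "J \<equiv> {1..}"

definition same_order :: "(nat \<Rightarrow> real) \<Rightarrow> (nat \<Rightarrow> real) \<Rightarrow> bool" (infix "\<simeq>" 50) where
  "v \<simeq> w \<longleftrightarrow> (\<exists>c\<^sub>1>0. \<exists>c\<^sub>2>0. \<forall>k\<ge>1. c\<^sub>1 * w k \<le> v k \<and> v k \<le> c\<^sub>2 * w k)"


section \<open>The sequence space and the ellipsoid\<close>

text \<open>Sequences indexed by \<^term>\<open>J\<close> are functions on \<^typ>\<open>nat\<close> whose value at 0 is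
  irrelevant: no quantity below depends on it.\<close>

definition l2 :: "(nat \<Rightarrow> real) set" where
  "l2 = {x. (\<lambda>j. (x j)\<^sup>2) summable_on J}"

definition l2_norm :: "(nat \<Rightarrow> real) \<Rightarrow> real" where
  "l2_norm x = sqrt (\<Sum>\<^sub>\<infinity>j\<in>J. (x j)\<^sup>2)"

text \<open>Summability has to be required explicitly, since \<^const>\<open>infsum\<close> is 0 for a divergent
  real series.\<close>

definition ellipsoid :: "(nat \<Rightarrow> real) \<Rightarrow> real \<Rightarrow> (nat \<Rightarrow> real) set" where
  "ellipsoid a R = {x \<in> l2. (\<lambda>j. (a j)\<^sup>2 * (x j)\<^sup>2) summable_on J \<and>
                            (\<Sum>\<^sub>\<infinity>j\<in>J. (a j)\<^sup>2 * (x j)\<^sup>2) \<le> R\<^sup>2}"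


section \<open>The statistical model\<close>

definition noise :: "(nat \<Rightarrow> real) measure" where
  "noise = (\<Pi>\<^sub>M j\<in>J. std_normal_distribution)"

definition obs_space :: "(nat \<Rightarrow> real) measure" where
  "obs_space = (\<Pi>\<^sub>M j\<in>J. borel)"

definition Z :: "(nat \<Rightarrow> real) \<Rightarrow> real \<Rightarrow> (nat \<Rightarrow> real) \<Rightarrow> (nat \<Rightarrow> real) \<Rightarrow> nat \<Rightarrow> real" where
  "Z b \<sigma> \<theta> \<epsilon> = (\<lambda>j\<in>J. b j * \<theta> j + \<sigma> * \<epsilon> j)"

definition Y :: "(nat \<Rightarrow> real) \<Rightarrow> real \<Rightarrow> (nat \<Rightarrow> real) \<Rightarrow> (nat \<Rightarrow> real) \<Rightarrow> nat \<Rightarrow> real" where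
  "Y b \<sigma> \<theta> \<epsilon> = (\<lambda>j\<in>J. inverse (b j) * Z b \<sigma> \<theta> \<epsilon> j)"

definition law :: "(nat \<Rightarrow> real) \<Rightarrow> real \<Rightarrow> (nat \<Rightarrow> real) \<Rightarrow> (nat \<Rightarrow> real) measure" where
  "law b \<sigma> \<theta> = distr noise obs_space (Y b \<sigma> \<theta>)"


section \<open>Tests and minimax rates of testing\<close>

definition tests :: "((nat \<Rightarrow> real) \<Rightarrow> nat) set" where
  "tests = obs_space \<rightarrow>\<^sub>M count_space {0, 1}"

definition reject_prob ::
  "(nat \<Rightarrow> real) \<Rightarrow> real \<Rightarrow> ((nat \<Rightarrow> real) \<Rightarrow> nat) \<Rightarrow> (nat \<Rightarrow> real) \<Rightarrow> real" where
  "reject_prob b \<sigma> \<Phi> \<theta> = measure (law b \<sigma> \<theta>) {y \<in> space (law b \<sigma> \<theta>). \<Phi> y = 1}"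

definition level_tests :: "(nat \<Rightarrow> real) \<Rightarrow> real \<Rightarrow> real \<Rightarrow> ((nat \<Rightarrow> real) \<Rightarrow> nat) set" where
  "level_tests b \<sigma> \<alpha> = {\<Phi> \<in> tests. reject_prob b \<sigma> \<Phi> (\<lambda>_. 0) \<le> \<alpha>}"

text \<open>The infima are taken in \<^typ>\<open>ereal\<close>, where the infimum of the empty set is
  \<open>\<infinity>\<close>; in particular a radius \<open>\<rho>\<close> exceeding the norms of all elements of \<open>F\<close> is admissible.\<close>

definition test_rate ::
  "(nat \<Rightarrow> real) \<Rightarrow> real \<Rightarrow> ((nat \<Rightarrow> real) \<Rightarrow> nat) \<Rightarrow> (nat \<Rightarrow> real) set \<Rightarrow> real \<Rightarrow> ereal" where
  "test_rate b \<sigma> \<Phi> F \<beta> =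
     Inf (ereal ` {\<rho>. 0 < \<rho> \<and>
       (INF \<theta>\<in>{\<theta> \<in> F. l2_norm \<theta> \<ge> \<rho>}. ereal (reject_prob b \<sigma> \<Phi> \<theta>)) > ereal (1 - \<beta>)})"

definition minimax_rate ::
  "(nat \<Rightarrow> real) \<Rightarrow> real \<Rightarrow> (nat \<Rightarrow> real) set \<Rightarrow> real \<Rightarrow> real \<Rightarrow> ereal" where
  "minimax_rate b \<sigma> F \<alpha> \<beta> = (INF \<Phi>\<in>level_tests b \<sigma> \<alpha>. test_rate b \<sigma> \<Phi> F \<beta>)"


section \<open>The cut-off dimension\<close>

definition c_const :: "real \<Rightarrow> real \<Rightarrow> real" where
  "c_const \<alpha> \<beta> = sqrt (2 * ln (1 + 4 * (1 - \<alpha> - \<beta>)\<^sup>2))"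

definition rho_sq :: "real \<Rightarrow> real \<Rightarrow> (nat \<Rightarrow> real) \<Rightarrow> real \<Rightarrow> nat \<Rightarrow> real" where
  "rho_sq \<alpha> \<beta> b \<sigma> D = c_const \<alpha> \<beta> * \<sigma>\<^sup>2 * sqrt (\<Sum>j=1..D. inverse (b j ^ 4))"

text \<open>The equation defining the cut-off dimension is solved over the nonnegative reals, so both
  sequences in it are extended from the integers by linear interpolation.\<close>

definition interpolate :: "(nat \<Rightarrow> real) \<Rightarrow> real \<Rightarrow> real" where
  "interpolate u x = (1 - frac x) * u (nat \<lfloor>x\<rfloor>) + frac x * u (nat \<lfloor>x\<rfloor> + 1)"

text \<open>On \<open>[0,1]\<close>, where there is no \<open>a\<close> to interpolate from at the left end, the right-hand side
  is kept at its value at 1; the left-hand side vanishes at 0 as an empty sum.  If \<open>\<rho>\<^sub>D\<^sup>2\<close> is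
  strictly increasing and unbounded and \<open>a\<close> is positive and non-decreasing, the solution exists
  and is unique, and its integer part is the largest \<open>D \<ge> 1\<close> with \<open>\<rho>\<^sub>D\<^sup>2 \<le> R\<^sup>2 a\<^sub>D\<^sup>-\<^sup>2\<close>, or 0 if there is
  no such \<open>D\<close>.  So it does not depend on the choice of a continuous monotone interpolation.\<close>

definition cutoff ::
  "real \<Rightarrow> real \<Rightarrow> real \<Rightarrow> (nat \<Rightarrow> real) \<Rightarrow> (nat \<Rightarrow> real) \<Rightarrow> real \<Rightarrow> nat" where
  "cutoff \<alpha> \<beta> R a b \<sigma> =
     nat \<lfloor>THE x. 0 \<le> x \<and> interpolate (rho_sq \<alpha> \<beta> b \<sigma>) x
                       = interpolate (\<lambda>D. R\<^sup>2 * inverse ((a (max 1 D))\<^sup>2)) x\<rfloor>"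

end

theory Submission
  imports Defs
begin

text \<open>
  The minimax rate is squeezed between two bounds that involve a free dimension \<open>D\<close>.  Write
  \<open>S\<^sub>D = \<sigma>\<^sup>2 (\<Sum>\<^sub>j\<^sub>\<le>\<^sub>D b\<^sub>j\<^sup>-\<^sup>4)\<^sup>1\<^sup>/\<^sup>2\<close>, the order of the standard deviation of \<open>\<Sum>Y\<^sub>j\<^sup>2\<close> over the first \<open>D\<close> coordinates
  under the null hypothesis; \<open>R\<^sup>2 a\<^sub>D\<^sup>-\<^sup>2\<close> is the largest squared norm of an element of the ellipsoid that lives
  on the coordinates from \<open>D\<close> on.

  Lower bound (\<open>minimax_rate_lower\<close>): the squared rate is at least \<open>min (c S\<^sub>D) (R\<^sup>2 a\<^sub>D\<^sup>-\<^sup>2)\<close> for every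
  \<open>D \<ge> 1\<close>.  Put random signs on a fixed signal living on \<open>{1..D}\<close>.  The mixture over the signs has a density
  with respect to the null distribution, a product of hyperbolic cosines with Gaussian factors, whose second moment is
  \<open>\<Prod>cosh(u\<^sub>j\<^sup>2) \<le> exp(\<Sum>u\<^sub>j\<^sup>4 / 2)\<close>.  While this is close to 1 no test tells the mixture from pure noise, so every test
  fails for one of the signals.

  Upper bound (\<open>minimax_rate_upper\<close>): the squared rate is at most \<open>K S\<^sub>D + R\<^sup>2 a\<^sub>D\<^sub>+\<^sub>1\<^sup>-\<^sup>2\<close> for every \<open>D \<ge> 0\<close>.
  The test rejects when \<open>\<Sum>(Y\<^sub>j\<^sup>2 - \<sigma>\<^sub>j\<^sup>2)\<close> over the first \<open>D\<close> coordinates is large; Chebyshev's inequality bounds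
  both of its errors.

  What remains is the choice of \<open>D\<close> in each of the four regimes.  For polynomial weights the two terms are
  balanced; when only one of the sequences is exponential, the other one dictates the rate, and \<open>D\<close> is, up to
  rounding, a multiple of a power of \<open>ln \<sigma>\<^sup>-\<^sup>2\<close>; when both are, \<open>D\<close> is the cut-off, which by \<open>cutoff_bracket\<close>
  is the last dimension at which \<open>c S\<^sub>D\<close> does not exceed \<open>R\<^sup>2 a\<^sub>D\<^sup>-\<^sup>2\<close>.
\<close>

section \<open>Shifts of Gaussian noise\<close>

lemma (in product_prob_space)
  assumes K: "finite K" "K \<subseteq> I"
  shows nn_integral_prod_coordinates:
    "(\<And>i. i \<in> K \<Longrightarrow> f i \<in> borel_measurable (M i)) \<Longrightarrow>
     (\<integral>\<^sup>+x. (\<Prod>i\<in>K. f i (x i)) \<partial>PiM I M) = (\<Prod>i\<in>K. integral\<^sup>N (M i) (f i))"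
    and integrable_prod_coordinates:
    "(\<And>i. i \<in> K \<Longrightarrow> integrable (M i) (g i)) \<Longrightarrow>
     integrable (PiM I M) (\<lambda>x. \<Prod>i\<in>K. g i (x i) :: real)"
    and integral_prod_coordinates:
    "(\<And>i. i \<in> K \<Longrightarrow> integrable (M i) (g i)) \<Longrightarrow>
     (\<integral>x. (\<Prod>i\<in>K. g i (x i)) \<partial>PiM I M) = (\<Prod>i\<in>K. integral\<^sup>L (M i) (g i))"
proof -
  have restr[measurable]: "(\<lambda>x. restrict x K) \<in> PiM I M \<rightarrow>\<^sub>M PiM K M"
    using K by (intro measurable_restrict_subset)
  have eq: "(\<Prod>i\<in>K. h i (restrict x K i)) = (\<Prod>i\<in>K. h i (x i))"
    for h :: "'i \<Rightarrow> 'a \<Rightarrow> 'c::comm_monoid_mult" and x by (rule prod.cong) auto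
  show "(\<integral>\<^sup>+x. (\<Prod>i\<in>K. f i (x i)) \<partial>PiM I M) = (\<Prod>i\<in>K. integral\<^sup>N (M i) (f i))"
    if f: "\<And>i. i \<in> K \<Longrightarrow> f i \<in> borel_measurable (M i)"
  proof -
    have m: "(\<lambda>x. \<Prod>i\<in>K. f i (x i)) \<in> borel_measurable (PiM K M)"
      by (intro borel_measurable_prod_ennreal)
         (rule measurable_compose[OF measurable_component_singleton[of _ K M] f], auto)
    show ?thesis
      using nn_integral_distr[OF restr, of "\<lambda>x. \<Prod>i\<in>K. f i (x i)"] m product_nn_integral_prod[OF K(1) f]
      by (simp add: distr_PiM_restrict_finite[OF K] eq)
  qed
  assume g: "\<And>i. i \<in> K \<Longrightarrow> integrable (M i) (g i)"
  have i: "integrable (PiM K M) (\<lambda>x. \<Prod>i\<in>K. g i (x i))"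
    by (rule product_integrable_prod[OF K(1) g])
  show "integrable (PiM I M) (\<lambda>x. \<Prod>i\<in>K. g i (x i))"
    using integrable_distr[OF restr, of "\<lambda>x. \<Prod>i\<in>K. g i (x i)"] i
    by (simp add: distr_PiM_restrict_finite[OF K] eq)
  show "(\<integral>x. (\<Prod>i\<in>K. g i (x i)) \<partial>PiM I M) = (\<Prod>i\<in>K. integral\<^sup>L (M i) (g i))"
    using integral_distr[OF restr, of "\<lambda>x. \<Prod>i\<in>K. g i (x i)"] i product_integral_prod[OF K(1) g]
    by (simp add: distr_PiM_restrict_finite[OF K] eq)
qed

abbreviation N :: "real measure" where "N \<equiv> std_normal_distribution"

interpretation N: prob_space N
  using prob_space_normal_density[of 1 0] by simp

interpretation coords: product_prob_space "\<lambda>_::nat. N" J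
  by unfold_locales

lemma sets_noise [measurable_cong]: "sets noise = sets obs_space"
  unfolding noise_def obs_space_def by (rule sets_PiM_cong) auto

interpretation noise: prob_space noise
  unfolding noise_def by unfold_locales

text \<open>Completing the square: the density of a shifted standard normal variable with respect to the
  unshifted one is an exponential tilt.\<close>

lemma nn_integral_tilted_normal:
  assumes A[measurable]: "A \<in> sets borel"
  shows "(\<integral>\<^sup>+x. ennreal (exp (h * x - h\<^sup>2 / 2)) * indicator A x \<partial>N) = emeasure N ((\<lambda>x. x + h) -` A)"
proof -
  have "(\<integral>\<^sup>+x. ennreal (exp (h * x - h\<^sup>2 / 2)) * indicator A x \<partial>N)
      = (\<integral>\<^sup>+x. ennreal (std_normal_density x) * (ennreal (exp (h * x - h\<^sup>2 / 2)) * indicator A x) \<partial>lborel)"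
    by (subst nn_integral_density) auto
  also have "\<dots> = (\<integral>\<^sup>+x. ennreal (std_normal_density (x - h)) * indicator A x \<partial>lborel)"
  proof (rule nn_integral_cong)
    fix x :: real
    have "std_normal_density x * exp (h * x - h\<^sup>2 / 2) = std_normal_density (x - h)"
      by (simp add: std_normal_density_def mult_exp_exp power2_eq_square field_simps)
    then show "ennreal (std_normal_density x) * (ennreal (exp (h * x - h\<^sup>2 / 2)) * indicator A x)
       = ennreal (std_normal_density (x - h)) * indicator A x"
      by (simp add: mult.assoc[symmetric] ennreal_mult[symmetric])
  qed
  also have "\<dots> = (\<integral>\<^sup>+x. ennreal (std_normal_density x) * indicator ((\<lambda>x. x + h) -` A) x \<partial>lborel)"
    by (subst nn_integral_real_affine[where t=h and c=1])
       (auto intro!: nn_integral_cong split: split_indicator simp: add.commute)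
  also have "\<dots> = emeasure N ((\<lambda>x. x + h) -` A)"
  proof (subst emeasure_density)
    have "(\<lambda>x. x + h) -` A \<inter> space borel \<in> sets borel"
      by (rule measurable_sets[OF _ A]) measurable
    then show "(\<lambda>x. x + h) -` A \<in> sets lborel" by simp
  qed auto
  finally show ?thesis .
qed

text \<open>Coordinate 0 lies outside \<open>J\<close> and must stay undefined, since points of \<^const>\<open>noise\<close> are extensional.\<close>

definition shift :: "(nat \<Rightarrow> real) \<Rightarrow> (nat \<Rightarrow> real) \<Rightarrow> nat \<Rightarrow> real" where
  "shift h \<epsilon> = (\<lambda>j\<in>J. \<epsilon> j + h j)"

lemma measurable_shift [measurable]: "shift h \<in> noise \<rightarrow>\<^sub>M noise"
  unfolding shift_def noise_def by measurable

text \<open>A shift of finitely many coordinates keeps the law of the noise absolutely continuous, and its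
  density is the product of the one-dimensional ones.  It is enough to compare both measures on
  cylinder sets; the set \<open>D\<close> of shifted coordinates and the set \<open>K\<close> of constrained coordinates are
  first enlarged to \<open>D \<union> K\<close>, with shift 0 or constraint \<^const>\<open>UNIV\<close> where one of them is absent.\<close>

lemma Cameron_Martin_finite:
  assumes D: "finite D" "D \<subseteq> J" and h: "\<And>j. j \<in> J - D \<Longrightarrow> h j = 0"
  shows "distr noise noise (shift h)
       = density noise (\<lambda>\<epsilon>. \<Prod>j\<in>D. ennreal (exp (h j * \<epsilon> j - (h j)\<^sup>2 / 2)))"
proof (rule measure_eqI_PiM_infinite[where I=J and M="\<lambda>_. N"])
  interpret P: prob_space "distr noise noise (shift h)"
    by (rule noise.prob_space_distr) measurable
  show "finite_measure (distr noise noise (shift h))" by unfold_locales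
next
  fix A :: "nat \<Rightarrow> real set" and K :: "nat set"
  assume K: "finite K" "K \<subseteq> J" and A: "\<And>i. i \<in> K \<Longrightarrow> A i \<in> sets N"
  define C where "C = prod_emb J (\<lambda>_. N) K (Pi\<^sub>E K A)"
  have C: "C \<in> sets noise"
    unfolding noise_def C_def by (rule sets_PiM_I) (use K A in auto)
  have Ceq: "x \<in> C \<longleftrightarrow> x \<in> space noise \<and> (\<forall>i\<in>K. x i \<in> A i)" for x
    using K by (auto simp: C_def prod_emb_def noise_def space_PiM PiE_iff)
  have [measurable]: "(\<lambda>\<epsilon>. \<epsilon> j) \<in> borel_measurable noise" if "j \<in> J" for j
    unfolding noise_def using that by measurable
  let ?T = "\<lambda>i. (\<lambda>x. x + h i) -` A i"
  have T: "?T i \<in> sets N" if "i \<in> K" for i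
  proof -
    have "?T i \<inter> space borel \<in> sets borel"
      using A[OF that] by (intro measurable_sets[of _ borel borel]) auto
    then show ?thesis by simp
  qed
  have "shift h x \<in> C \<longleftrightarrow> (\<forall>i\<in>K. x i \<in> ?T i)" if "x \<in> space noise" for x
  proof -
    have "shift h x i = x i + h i" if "i \<in> K" for i
      using that K by (auto simp: shift_def)
    then show ?thesis
      using measurable_space[OF measurable_shift that, of h] by (auto simp: Ceq)
  qed
  then have "shift h -` C \<inter> space noise = {x\<in>space (PiM J (\<lambda>_. N)). \<forall>i\<in>K. x i \<in> ?T i}"
    by (auto simp: noise_def)
  moreover have "emeasure noise {x\<in>space (PiM J (\<lambda>_. N)). \<forall>i\<in>K. x i \<in> ?T i} = (\<Prod>i\<in>K. emeasure N (?T i))"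
    unfolding noise_def by (rule coords.emeasure_PiM_Collect[OF K(2,1) T])
  ultimately have "emeasure (distr noise noise (shift h)) C = (\<Prod>i\<in>K. emeasure N (?T i))"
    using C by (simp add: emeasure_distr)
  also have "\<dots> = (\<Prod>i\<in>D\<union>K. if i \<in> K then emeasure N (?T i) else 1)"
    by (rule prod.mono_neutral_cong_left) (use K D in auto)
  also have "\<dots> = (\<Prod>i\<in>D\<union>K. \<integral>\<^sup>+x. ennreal (exp (h i * x - (h i)\<^sup>2 / 2))
                        * indicator (if i \<in> K then A i else UNIV) x \<partial>N)"
    using A N.emeasure_space_1 by (intro prod.cong refl) (simp add: nn_integral_tilted_normal)
  also have "\<dots> = (\<integral>\<^sup>+\<epsilon>. (\<Prod>i\<in>D\<union>K. ennreal (exp (h i * \<epsilon> i - (h i)\<^sup>2 / 2))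
                        * indicator (if i \<in> K then A i else UNIV) (\<epsilon> i)) \<partial>noise)"
    unfolding noise_def
  proof (rule coords.nn_integral_prod_coordinates[symmetric])
    fix i assume "i \<in> D \<union> K"
    then have [measurable]: "(if i \<in> K then A i else UNIV) \<in> sets borel" using A by auto
    show "(\<lambda>x. ennreal (exp (h i * x - (h i)\<^sup>2 / 2)) * indicator (if i \<in> K then A i else UNIV) x)
        \<in> borel_measurable N" by simp
  qed (use K D in auto)
  also have "\<dots> = (\<integral>\<^sup>+\<epsilon>. (\<Prod>j\<in>D. ennreal (exp (h j * \<epsilon> j - (h j)\<^sup>2 / 2))) * indicator C \<epsilon> \<partial>noise)"
  proof (rule nn_integral_cong)
    fix \<epsilon> assume \<epsilon>: "\<epsilon> \<in> space noise"
    have 1: "(\<Prod>i\<in>D\<union>K. ennreal (exp (h i * \<epsilon> i - (h i)\<^sup>2 / 2)))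
        = (\<Prod>i\<in>D. ennreal (exp (h i * \<epsilon> i - (h i)\<^sup>2 / 2)))"
      using K D h by (intro prod.mono_neutral_right) (auto simp: subset_iff)
    have 2: "(\<Prod>i\<in>D\<union>K. indicator (if i \<in> K then A i else UNIV) (\<epsilon> i)) = (indicator C \<epsilon> :: ennreal)"
    proof (cases "\<epsilon> \<in> C")
      case True then show ?thesis by (auto simp: Ceq intro!: prod.neutral)
    next
      case False
      then obtain i where "i \<in> K" "\<epsilon> i \<notin> A i" using \<epsilon> by (auto simp: Ceq)
      then have "\<exists>i\<in>D\<union>K. indicator (if i \<in> K then A i else UNIV) (\<epsilon> i) = (0::ennreal)"
        by (intro bexI[of _ i]) auto
      then show ?thesis using False K D prod_zero[of "D \<union> K"] by simp
    qed
    show "(\<Prod>i\<in>D\<union>K. ennreal (exp (h i * \<epsilon> i - (h i)\<^sup>2 / 2))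
                        * indicator (if i \<in> K then A i else UNIV) (\<epsilon> i))
      = (\<Prod>j\<in>D. ennreal (exp (h j * \<epsilon> j - (h j)\<^sup>2 / 2))) * indicator C \<epsilon>"
      unfolding prod.distrib 1 2 ..
  qed
  also have "\<dots> = emeasure (density noise (\<lambda>\<epsilon>. \<Prod>j\<in>D. ennreal (exp (h j * \<epsilon> j - (h j)\<^sup>2 / 2)))) C"
    using D C by (intro emeasure_density[symmetric] borel_measurable_prod_ennreal) auto
  finally show "emeasure (distr noise noise (shift h)) (prod_emb J (\<lambda>_. N) K (Pi\<^sub>E K A))
     = emeasure (density noise (\<lambda>\<epsilon>. \<Prod>j\<in>D. ennreal (exp (h j * \<epsilon> j - (h j)\<^sup>2 / 2)))) (prod_emb J (\<lambda>_. N) K (Pi\<^sub>E K A))"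
    unfolding C_def .
qed (auto simp: noise_def)

section \<open>Mixtures of shifts over random signs\<close>

text \<open>The function \<open>cosh x * exp (- x\<^sup>2 / 2)\<close> equals 1 at 0 and decreases on the positive half-line,
  because \<open>tanh x \<le> x\<close> there.\<close>

lemma cosh_le_exp_half_square:
  fixes x :: real assumes "0 \<le> x" shows "cosh x \<le> exp (x\<^sup>2 / 2)"
proof -
  have sinh: "sinh y \<le> y * cosh y" if "0 \<le> y" for y :: real
  proof -
    have "0 * cosh 0 - sinh 0 \<le> y * cosh y - sinh y"
    proof (rule DERIV_nonneg_imp_nondecreasing[OF that])
      fix z :: real assume "0 \<le> z"
      have "((\<lambda>y. y * cosh y - sinh y) has_real_derivative z * sinh z) (at z)"
        by (auto intro!: derivative_eq_intros)
      then show "\<exists>d. ((\<lambda>y. y * cosh y - sinh y) has_real_derivative d) (at z) \<and> 0 \<le> d"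
        using \<open>0 \<le> z\<close> by (intro exI[of _ "z * sinh z"]) auto
    qed
    then show ?thesis by simp
  qed
  have "cosh x * exp (- (x\<^sup>2 / 2)) \<le> cosh 0 * exp (- (0\<^sup>2 / 2))"
  proof (rule DERIV_nonpos_imp_nonincreasing[OF assms])
    fix z :: real assume z: "0 \<le> z"
    have "((\<lambda>y. cosh y * exp (- (y\<^sup>2 / 2))) has_real_derivative
            (sinh z - z * cosh z) * exp (- (z\<^sup>2 / 2))) (at z)"
      by (auto intro!: derivative_eq_intros simp: algebra_simps)
    then show "\<exists>d. ((\<lambda>y. cosh y * exp (- (y\<^sup>2 / 2))) has_real_derivative d) (at z) \<and> d \<le> 0"
      using sinh[OF z] by (intro exI conjI) (auto simp: mult_nonpos_nonneg)
  qed
  then show ?thesis by (simp add: exp_minus divide_simps)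
qed

lemma has_bochner_integral_tilt:
  "has_bochner_integral N (\<lambda>x. exp (h * x - h\<^sup>2 / 2)) 1"
proof (rule has_bochner_integral_nn_integral)
  show "(\<integral>\<^sup>+x. ennreal (exp (h * x - h\<^sup>2 / 2)) \<partial>N) = ennreal 1"
    using nn_integral_tilted_normal[of UNIV h] N.emeasure_space_1 by simp
qed auto

text \<open>Likelihood ratio in one coordinate when the shift is \<open>u\<close> or \<open>- u\<close> with probability 1/2 each.\<close>

definition mixed_tilt :: "real \<Rightarrow> real \<Rightarrow> real" where
  "mixed_tilt u x = cosh (u * x) * exp (- (u\<^sup>2 / 2))"

lemma mixed_tilt_eq: "2 * mixed_tilt u x = (\<Sum>s\<in>{-1, 1}. exp (s * u * x - (s * u)\<^sup>2 / 2))"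
proof -
  have "exp (u * x - u\<^sup>2 / 2) = exp (u * x) * exp (- (u\<^sup>2 / 2))"
    "exp (- (u * x) - u\<^sup>2 / 2) = exp (- (u * x)) * exp (- (u\<^sup>2 / 2))"
    by (simp_all add: mult_exp_exp)
  then show ?thesis by (simp add: mixed_tilt_def cosh_field_def algebra_simps)
qed

text \<open>The value \<open>cosh (u\<^sup>2)\<close> is why random signs help: it is \<open>1 + O(u\<^sup>4)\<close>, whereas the likelihood ratio of
  the deterministic shift \<open>u\<close> has second moment \<open>exp (u\<^sup>2) = 1 + O(u\<^sup>2)\<close>.\<close>

lemma mixed_tilt_moments:
  shows has_bochner_integral_mixed_tilt: "has_bochner_integral N (mixed_tilt u) 1"
    and has_bochner_integral_mixed_tilt_square:
      "has_bochner_integral N (\<lambda>x. (mixed_tilt u x)\<^sup>2) (cosh (u\<^sup>2))"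
proof -
  have "has_bochner_integral N
     (\<lambda>x. (exp (u * x - u\<^sup>2 / 2) + exp (- u * x - (- u)\<^sup>2 / 2)) / 2) ((1 + 1) / 2)"
    by (intro has_bochner_integral_divide_zero has_bochner_integral_add has_bochner_integral_tilt)
  also have "(\<lambda>x. (exp (u * x - u\<^sup>2 / 2) + exp (- u * x - (- u)\<^sup>2 / 2)) / 2) = mixed_tilt u"
    using mixed_tilt_eq[of u] by (auto simp: fun_eq_iff algebra_simps)
  finally show "has_bochner_integral N (mixed_tilt u) 1" by simp
  have "has_bochner_integral N
     (\<lambda>x. (exp (u\<^sup>2) * exp (2 * u * x - (2 * u)\<^sup>2 / 2) + exp (u\<^sup>2) * exp (- 2 * u * x - (- 2 * u)\<^sup>2 / 2)
            + 2 * exp (- u\<^sup>2)) / 4)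
     ((exp (u\<^sup>2) * 1 + exp (u\<^sup>2) * 1 + 2 * exp (- u\<^sup>2)) / 4)"
    by (intro has_bochner_integral_divide_zero has_bochner_integral_add
          has_bochner_integral_mult_right has_bochner_integral_tilt)
       (use N.prob_space in \<open>simp add: has_bochner_integral_iff\<close>)
  also have "(\<lambda>x. (exp (u\<^sup>2) * exp (2 * u * x - (2 * u)\<^sup>2 / 2) + exp (u\<^sup>2) * exp (- 2 * u * x - (- 2 * u)\<^sup>2 / 2)
            + 2 * exp (- u\<^sup>2)) / 4) = (\<lambda>x. (mixed_tilt u x)\<^sup>2)"
  proof
    fix x
    have "exp (u\<^sup>2) * exp (2 * u * x - (2 * u)\<^sup>2 / 2) = (exp (u * x))\<^sup>2 * (exp (- (u\<^sup>2 / 2)))\<^sup>2"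
      "exp (u\<^sup>2) * exp (- 2 * u * x - (- 2 * u)\<^sup>2 / 2) = (exp (- (u * x)))\<^sup>2 * (exp (- (u\<^sup>2 / 2)))\<^sup>2"
      "exp (- u\<^sup>2) = (exp (- (u\<^sup>2 / 2)))\<^sup>2"
      "exp (u * x) * exp (- (u * x)) = 1"
      by (simp_all add: power2_eq_square mult_exp_exp algebra_simps)
    moreover have "((p + q) / 2 * e)\<^sup>2 = (p\<^sup>2 * e\<^sup>2 + q\<^sup>2 * e\<^sup>2 + 2 * (p * q) * e\<^sup>2) / 4" for p q e :: real
      by (simp add: power2_eq_square field_simps)
    ultimately show "(exp (u\<^sup>2) * exp (2 * u * x - (2 * u)\<^sup>2 / 2) + exp (u\<^sup>2) * exp (- 2 * u * x - (- 2 * u)\<^sup>2 / 2)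
            + 2 * exp (- u\<^sup>2)) / 4 = (mixed_tilt u x)\<^sup>2"
      by (simp only: mixed_tilt_def cosh_field_def mult_1_right)
  qed
  finally show "has_bochner_integral N (\<lambda>x. (mixed_tilt u x)\<^sup>2) (cosh (u\<^sup>2))"
    by (simp add: cosh_field_def add_divide_distrib)
qed

lemma (in prob_space) expectation_abs_le_sqrt:
  fixes f :: "'a \<Rightarrow> real"
  assumes [measurable]: "f \<in> borel_measurable M" and i: "integrable M (\<lambda>x. (f x)\<^sup>2)"
  shows "expectation (\<lambda>x. \<bar>f x\<bar>) \<le> sqrt (expectation (\<lambda>x. (f x)\<^sup>2))"
proof -
  have "integrable M (\<lambda>x. \<bar>f x\<bar>)"
    using square_integrable_imp_integrable[of f] i by auto
  then have "variance (\<lambda>x. \<bar>f x\<bar>) = expectation (\<lambda>x. (f x)\<^sup>2) - (expectation (\<lambda>x. \<bar>f x\<bar>))\<^sup>2"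
    using i by (subst variance_eq) auto
  then show ?thesis
    using variance_positive[of "\<lambda>x. \<bar>f x\<bar>"] by (intro real_le_rsqrt) simp
qed

text \<open>The shift with absolute values \<open>u\<close> and signs \<open>\<omega>\<close> on \<open>D\<close>; it is 0 elsewhere so that it fits
  \<open>Cameron_Martin_finite\<close>.\<close>

definition signed :: "nat set \<Rightarrow> (nat \<Rightarrow> real) \<Rightarrow> (nat \<Rightarrow> real) \<Rightarrow> nat \<Rightarrow> real" where
  "signed D u \<omega> j = (if j \<in> D then \<omega> j * u j else 0)"

lemma prob_shift:
  assumes D: "finite D" "D \<subseteq> J" and h: "\<And>j. j \<in> J - D \<Longrightarrow> h j = 0" and G: "G \<in> sets noise"
  shows "integrable noise (\<lambda>\<epsilon>. indicator G \<epsilon> * (\<Prod>j\<in>D. exp (h j * \<epsilon> j - (h j)\<^sup>2 / 2)))"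
    and "noise.prob (shift h -` G \<inter> space noise)
       = (\<integral>\<epsilon>. indicator G \<epsilon> * (\<Prod>j\<in>D. exp (h j * \<epsilon> j - (h j)\<^sup>2 / 2)) \<partial>noise)"
proof -
  have int: "integrable noise (\<lambda>\<epsilon>. \<Prod>j\<in>D. exp (h j * \<epsilon> j - (h j)\<^sup>2 / 2))"
    unfolding noise_def
    using has_bochner_integral_tilt by (intro coords.integrable_prod_coordinates D) (auto simp: has_bochner_integral_iff)
  then show i: "integrable noise (\<lambda>\<epsilon>. indicator G \<epsilon> * (\<Prod>j\<in>D. exp (h j * \<epsilon> j - (h j)\<^sup>2 / 2)))"
    using integrable_mult_indicator[OF G int] by simp
  from int have m[measurable]: "(\<lambda>\<epsilon>. \<Prod>j\<in>D. exp (h j * \<epsilon> j - (h j)\<^sup>2 / 2)) \<in> borel_measurable noise"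
    by auto
  have CM: "distr noise noise (shift h)
       = density noise (\<lambda>\<epsilon>. \<Prod>j\<in>D. ennreal (exp (h j * \<epsilon> j - (h j)\<^sup>2 / 2)))"
    by (rule Cameron_Martin_finite[OF D]) (use h in auto)
  have "emeasure noise (shift h -` G \<inter> space noise) = emeasure (distr noise noise (shift h)) G"
    using G by (simp add: emeasure_distr)
  also have "\<dots> = (\<integral>\<^sup>+\<epsilon>. ennreal (indicator G \<epsilon> * (\<Prod>j\<in>D. exp (h j * \<epsilon> j - (h j)\<^sup>2 / 2))) \<partial>noise)"
    using G unfolding CM prod_ennreal[OF exp_ge_zero]
    by (subst emeasure_density) (auto intro!: nn_integral_cong split: split_indicator)
  also have "\<dots> = ennreal (\<integral>\<epsilon>. indicator G \<epsilon> * (\<Prod>j\<in>D. exp (h j * \<epsilon> j - (h j)\<^sup>2 / 2)) \<partial>noise)"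
    using i by (intro nn_integral_eq_integral) (auto intro!: AE_I2 mult_nonneg_nonneg prod_nonneg)
  finally show "noise.prob (shift h -` G \<inter> space noise)
       = (\<integral>\<epsilon>. indicator G \<epsilon> * (\<Prod>j\<in>D. exp (h j * \<epsilon> j - (h j)\<^sup>2 / 2)) \<partial>noise)"
    by (subst measure_eq_emeasure_eq_ennreal) (auto intro!: Bochner_Integration.integral_nonneg mult_nonneg_nonneg prod_nonneg)
qed

text \<open>Under uniformly random signs the average of the probabilities of \<open>G\<close> is the probability of \<open>G\<close> under
  the mixture with likelihood ratio \<open>L\<close>, the product of the mixed tilts, so some choice of signs does
  not exceed that average.  The mixture differs from the unshifted law by at most half the
  \<open>L\<^sup>1\<close> norm of \<open>L - 1\<close>, hence by half its \<open>L\<^sup>2\<close> norm, which is computed coordinate by coordinate.\<close>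

lemma exists_hard_signs:
  assumes D: "finite D" "D \<subseteq> J" and G: "G \<in> sets noise"
  shows "\<exists>\<omega>\<in>D \<rightarrow>\<^sub>E {-1, 1}. noise.prob (shift (signed D u \<omega>) -` G \<inter> space noise)
           \<le> noise.prob G + sqrt (exp ((\<Sum>j\<in>D. u j ^ 4) / 2) - 1) / 2"
proof -
  define L where "L \<epsilon> = (\<Prod>j\<in>D. mixed_tilt (u j) (\<epsilon> j))" for \<epsilon> :: "nat \<Rightarrow> real"
  define S where "S = (D \<rightarrow>\<^sub>E {-1, 1 :: real})"
  have S: "finite S" "card S = 2 ^ card D"
    unfolding S_def using D by (auto simp: finite_PiE card_PiE numeral_2_eq_2)
  have L: "integrable noise L" "(\<integral>\<epsilon>. L \<epsilon> \<partial>noise) = 1"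
    unfolding L_def noise_def
    using coords.integrable_prod_coordinates[OF D, of "\<lambda>j. mixed_tilt (u j)"]
      coords.integral_prod_coordinates[OF D, of "\<lambda>j. mixed_tilt (u j)"] has_bochner_integral_mixed_tilt
    by (auto simp: has_bochner_integral_iff)
  have L2: "integrable noise (\<lambda>\<epsilon>. (L \<epsilon>)\<^sup>2)" "(\<integral>\<epsilon>. (L \<epsilon>)\<^sup>2 \<partial>noise) = (\<Prod>j\<in>D. cosh ((u j)\<^sup>2))"
    unfolding L_def noise_def prod_power_distrib
    using coords.integrable_prod_coordinates[OF D, of "\<lambda>j x. (mixed_tilt (u j) x)\<^sup>2"]
      coords.integral_prod_coordinates[OF D, of "\<lambda>j x. (mixed_tilt (u j) x)\<^sup>2"]
      has_bochner_integral_mixed_tilt_square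
    by (auto simp: has_bochner_integral_iff)
  have [measurable]: "L \<in> borel_measurable noise" using L(1) by auto
  have GL: "integrable noise (\<lambda>\<epsilon>. indicator G \<epsilon> * L \<epsilon>)"
    using integrable_mult_indicator[OF G L(1)] by simp
  have Gi: "integrable noise (indicator G :: _ \<Rightarrow> real)" "(\<integral>\<epsilon>. indicator G \<epsilon> \<partial>noise) = noise.prob G"
    using G by (auto simp: integrable_indicator_iff noise.emeasure_finite less_top[symmetric])
  have chi: "(\<integral>\<epsilon>. (L \<epsilon> - 1)\<^sup>2 \<partial>noise) \<le> exp ((\<Sum>j\<in>D. u j ^ 4) / 2) - 1"
    and chi_int: "integrable noise (\<lambda>\<epsilon>. (L \<epsilon> - 1)\<^sup>2)"
  proof -
    have eq: "(\<lambda>\<epsilon>. (L \<epsilon> - 1)\<^sup>2) = (\<lambda>\<epsilon>. (L \<epsilon>)\<^sup>2 - 2 * L \<epsilon> + 1)"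
      by (simp add: power2_diff algebra_simps)
    show "integrable noise (\<lambda>\<epsilon>. (L \<epsilon> - 1)\<^sup>2)" unfolding eq using L L2 by auto
    have "(\<integral>\<epsilon>. (L \<epsilon> - 1)\<^sup>2 \<partial>noise) = (\<Prod>j\<in>D. cosh ((u j)\<^sup>2)) - 1"
      unfolding eq using L L2 by (simp add: noise.prob_space)
    also have "(\<Prod>j\<in>D. cosh ((u j)\<^sup>2)) \<le> (\<Prod>j\<in>D. exp (u j ^ 4 / 2))"
      using cosh_le_exp_half_square[of "(u _)\<^sup>2"]
      by (intro prod_mono) (auto simp: power_mult[symmetric])
    also have "\<dots> = exp ((\<Sum>j\<in>D. u j ^ 4) / 2)"
      using D by (simp add: exp_sum sum_divide_distrib)
    finally show "(\<integral>\<epsilon>. (L \<epsilon> - 1)\<^sup>2 \<partial>noise) \<le> exp ((\<Sum>j\<in>D. u j ^ 4) / 2) - 1" by simp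
  qed
  \<comment> \<open>Since \<open>L - 1\<close> has mean 0, the indicator may be centred at 1/2, which gains the factor 1/2.\<close>
  have "(\<integral>\<epsilon>. indicator G \<epsilon> * L \<epsilon> \<partial>noise) - noise.prob G
      = (\<integral>\<epsilon>. (indicator G \<epsilon> - 1 / 2) * (L \<epsilon> - 1) \<partial>noise)"
  proof -
    have "(\<integral>\<epsilon>. (indicator G \<epsilon> - 1 / 2) * (L \<epsilon> - 1) \<partial>noise)
        = (\<integral>\<epsilon>. indicator G \<epsilon> * L \<epsilon> - indicator G \<epsilon> - (L \<epsilon> - 1) / 2 \<partial>noise)"
      by (simp add: algebra_simps diff_divide_distrib)
    also have "\<dots> = (\<integral>\<epsilon>. indicator G \<epsilon> * L \<epsilon> \<partial>noise) - noise.prob G - (1 - 1) / 2"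
      using GL Gi L by (simp add: noise.prob_space)
    finally show ?thesis by simp
  qed
  also have "\<dots> \<le> (\<integral>\<epsilon>. \<bar>L \<epsilon> - 1\<bar> / 2 \<partial>noise)"
  proof (rule integral_mono)
    have "(\<lambda>\<epsilon>. (indicator G \<epsilon> - 1 / 2) * (L \<epsilon> - 1)) =
      (\<lambda>\<epsilon>. indicator G \<epsilon> * L \<epsilon> - indicator G \<epsilon> - (L \<epsilon> - 1) / 2)"
      by (simp add: algebra_simps diff_divide_distrib)
    then show "integrable noise (\<lambda>\<epsilon>. (indicator G \<epsilon> - 1 / 2) * (L \<epsilon> - 1))"
      using GL Gi L by simp
    show "(indicator G \<epsilon> - 1 / 2) * (L \<epsilon> - 1) \<le> \<bar>L \<epsilon> - 1\<bar> / 2" for \<epsilon>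
      by (auto split: split_indicator simp: abs_if field_simps)
  qed (use L in auto)
  also have "\<dots> \<le> sqrt (exp ((\<Sum>j\<in>D. u j ^ 4) / 2) - 1) / 2"
    using noise.expectation_abs_le_sqrt[of "\<lambda>\<epsilon>. L \<epsilon> - 1"] chi chi_int
    by (simp add: order_trans[OF _ real_sqrt_le_mono[OF chi]])
  finally have mix: "(\<integral>\<epsilon>. indicator G \<epsilon> * L \<epsilon> \<partial>noise)
      \<le> noise.prob G + sqrt (exp ((\<Sum>j\<in>D. u j ^ 4) / 2) - 1) / 2" by simp
  let ?p = "\<lambda>\<omega>. noise.prob (shift (signed D u \<omega>) -` G \<inter> space noise)"
  have "(\<Sum>\<omega>\<in>S. ?p \<omega>)
      = (\<Sum>\<omega>\<in>S. \<integral>\<epsilon>. indicator G \<epsilon> * (\<Prod>j\<in>D. exp (signed D u \<omega> j * \<epsilon> j - (signed D u \<omega> j)\<^sup>2 / 2)) \<partial>noise)"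
    using D G by (intro sum.cong prob_shift) (auto simp: signed_def)
  also have "\<dots> = (\<integral>\<epsilon>. (\<Sum>\<omega>\<in>S. indicator G \<epsilon> *
       (\<Prod>j\<in>D. exp (signed D u \<omega> j * \<epsilon> j - (signed D u \<omega> j)\<^sup>2 / 2))) \<partial>noise)"
    using D G by (intro Bochner_Integration.integral_sum[symmetric] prob_shift(1)) (auto simp: signed_def)
  also have "\<dots> = (\<integral>\<epsilon>. 2 ^ card D * (indicator G \<epsilon> * L \<epsilon>) \<partial>noise)"
  proof (rule Bochner_Integration.integral_cong[OF refl])
    fix \<epsilon>
    have "(\<Sum>\<omega>\<in>S. (\<Prod>j\<in>D. exp (signed D u \<omega> j * \<epsilon> j - (signed D u \<omega> j)\<^sup>2 / 2)))
        = (\<Sum>\<omega>\<in>S. (\<Prod>j\<in>D. exp (\<omega> j * u j * \<epsilon> j - (\<omega> j * u j)\<^sup>2 / 2)))"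
      by (intro sum.cong prod.cong) (auto simp: signed_def)
    also have "\<dots> = (\<Prod>j\<in>D. \<Sum>s\<in>{-1, 1}. exp (s * u j * \<epsilon> j - (s * u j)\<^sup>2 / 2))"
      unfolding S_def using D by (intro prod_sum_PiE[symmetric]) auto
    also have "\<dots> = 2 ^ card D * L \<epsilon>"
      unfolding mixed_tilt_eq[symmetric] L_def by (simp add: prod.distrib)
    finally show "(\<Sum>\<omega>\<in>S. indicator G \<epsilon> *
       (\<Prod>j\<in>D. exp (signed D u \<omega> j * \<epsilon> j - (signed D u \<omega> j)\<^sup>2 / 2))) = 2 ^ card D * (indicator G \<epsilon> * L \<epsilon>)"
      by (simp add: sum_distrib_left[symmetric])
  qed
  also have "\<dots> = card S * (\<integral>\<epsilon>. indicator G \<epsilon> * L \<epsilon> \<partial>noise)"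
    using S by simp
  finally have avg: "(\<Sum>\<omega>\<in>S. ?p \<omega>) = card S * (\<integral>\<epsilon>. indicator G \<epsilon> * L \<epsilon> \<partial>noise)" .
  show ?thesis
  proof (rule ccontr)
    assume "\<not> ?thesis"
    then have "?p \<omega> > (\<integral>\<epsilon>. indicator G \<epsilon> * L \<epsilon> \<partial>noise)" if "\<omega> \<in> S" for \<omega>
      using mix that unfolding S_def by fastforce
    moreover have "S \<noteq> {}" using S by auto
    ultimately have "(\<Sum>\<omega>\<in>S. ?p \<omega>) > (\<Sum>\<omega>\<in>S. \<integral>\<epsilon>. indicator G \<epsilon> * L \<epsilon> \<partial>noise)"
      using S by (intro sum_strict_mono)
    with avg show False by simp
  qed
qed

section \<open>The lower bound\<close>

lemma Y_eq: "Y b \<sigma> \<theta> = (\<lambda>\<epsilon>. \<lambda>j\<in>J. inverse (b j) * (b j * \<theta> j + \<sigma> * \<epsilon> j))"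
  by (auto simp: Y_def Z_def fun_eq_iff)

lemma measurable_Y [measurable]: "Y b \<sigma> \<theta> \<in> noise \<rightarrow>\<^sub>M obs_space"
  unfolding Y_eq noise_def obs_space_def by measurable

lemma reject_prob_eq:
  assumes "\<Phi> \<in> tests"
  shows "reject_prob b \<sigma> \<Phi> \<theta> = noise.prob {\<epsilon> \<in> space noise. \<Phi> (Y b \<sigma> \<theta> \<epsilon>) = 1}"
    and "{y \<in> space obs_space. \<Phi> y = 1} \<in> sets obs_space"
proof -
  have "\<Phi> -` {1} \<inter> space obs_space \<in> sets obs_space"
    using assms unfolding tests_def by (rule measurable_sets) auto
  then show m: "{y \<in> space obs_space. \<Phi> y = 1} \<in> sets obs_space"
    by (simp add: vimage_def Int_def conj_commute)
  have "Y b \<sigma> \<theta> -` {y \<in> space obs_space. \<Phi> y = 1} \<inter> space noise = {\<epsilon> \<in> space noise. \<Phi> (Y b \<sigma> \<theta> \<epsilon>) = 1}"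
    using measurable_space[OF measurable_Y] by auto
  then show "reject_prob b \<sigma> \<Phi> \<theta> = noise.prob {\<epsilon> \<in> space noise. \<Phi> (Y b \<sigma> \<theta> \<epsilon>) = 1}"
    unfolding reject_prob_def law_def using m by (simp add: measure_distr)
qed

lemma Y_shift:
  assumes "0 < \<sigma>"
  shows "Y b \<sigma> \<theta> \<epsilon> = Y b \<sigma> (\<lambda>_. 0) (shift (\<lambda>j. b j * \<theta> j / \<sigma>) \<epsilon>)"
  using assms by (auto simp: Y_eq shift_def fun_eq_iff distrib_left)

lemma ereal_power2_mono: "0 \<le> x \<Longrightarrow> x \<le> y \<Longrightarrow> x\<^sup>2 \<le> (y\<^sup>2 :: ereal)"
  by (simp add: power2_eq_square ereal_mult_mono)

lemma minimax_rate_geI: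
  assumes "\<And>\<Phi>. \<Phi> \<in> level_tests b \<sigma> \<alpha> \<Longrightarrow> \<exists>\<theta>\<in>F. l2_norm \<theta> \<ge> r \<and> reject_prob b \<sigma> \<Phi> \<theta> \<le> 1 - \<beta>"
  shows "ereal r \<le> minimax_rate b \<sigma> F \<alpha> \<beta>"
  unfolding minimax_rate_def test_rate_def
proof (rule INF_greatest, rule Inf_greatest)
  fix \<Phi> x
  assume \<Phi>: "\<Phi> \<in> level_tests b \<sigma> \<alpha>"
  assume "x \<in> ereal ` {\<rho>. 0 < \<rho> \<and>
       (INF \<theta>\<in>{\<theta> \<in> F. l2_norm \<theta> \<ge> \<rho>}. ereal (reject_prob b \<sigma> \<Phi> \<theta>)) > ereal (1 - \<beta>)}"
  then obtain \<rho> where x: "x = ereal \<rho>"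
    and \<rho>: "ereal (1 - \<beta>) < (INF \<theta>\<in>{\<theta> \<in> F. \<rho> \<le> l2_norm \<theta>}. ereal (reject_prob b \<sigma> \<Phi> \<theta>))"
    by auto
  obtain \<theta> where \<theta>: "\<theta> \<in> F" "r \<le> l2_norm \<theta>" "reject_prob b \<sigma> \<Phi> \<theta> \<le> 1 - \<beta>"
    using assms[OF \<Phi>] by auto
  show "ereal r \<le> x"
  proof (rule ccontr)
    assume "\<not> ereal r \<le> x"
    then have "\<theta> \<in> {\<theta> \<in> F. \<rho> \<le> l2_norm \<theta>}" using \<theta> x by simp
    then have "(INF \<theta>\<in>{\<theta> \<in> F. \<rho> \<le> l2_norm \<theta>}. ereal (reject_prob b \<sigma> \<Phi> \<theta>)) \<le> ereal (reject_prob b \<sigma> \<Phi> \<theta>)"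
      by (rule INF_lower)
    with \<rho> \<theta> show False by (meson ereal_less_eq(3) leD le_less_trans order_less_le_trans)
  qed
qed

lemma infsum_finite_support:
  fixes f :: "nat \<Rightarrow> real"
  assumes "\<And>j. j \<in> J - {1..D} \<Longrightarrow> f j = 0"
  shows "f summable_on J" "infsum f J = sum f {1..D}"
proof -
  have "(f has_sum sum f {1..D}) {1..D}" by (rule has_sum_finite) auto
  then have "(f has_sum sum f {1..D}) J"
    by (rule has_sum_cong_neutral[THEN iffD1, rotated -1]) (use assms in auto)
  then show "f summable_on J" "infsum f J = sum f {1..D}"
    by (auto simp: has_sum_imp_summable infsumI)
qed

lemma sum_inverse_pow4_pos:
  assumes "\<forall>j\<in>J. 0 < b j" "1 \<le> D"
  shows "0 < (\<Sum>j=1..D. inverse (b j ^ 4) :: real)"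
proof (intro sum_pos)
  fix i assume "i \<in> {1..D}"
  then have "0 < b i" using assms by auto
  then show "0 < inverse (b i ^ 4)" by simp
qed (use assms in auto)

lemma c_const_pos: "\<beta> < 1 - \<alpha> \<Longrightarrow> 0 < c_const \<alpha> \<beta>"
  by (simp add: c_const_def) (intro ln_gt_zero, simp)

text \<open>The signals used have squares proportional to \<open>b\<^sub>j\<^sup>-\<^sup>4\<close> on \<open>{1..D}\<close>.  Among all signals of given norm
  supported there, this profile minimises \<open>\<Sum>u\<^sub>j\<^sup>4\<close>, where \<open>u\<^sub>j = b\<^sub>j \<theta>\<^sub>j / \<sigma>\<close> is the shift of the standardised
  noise, and so makes the mixture over signs hardest to detect.  The constant \<^const>\<open>c_const\<close> is such that the
  deviation in \<open>exists_hard_signs\<close> is at most \<open>1 - \<alpha> - \<beta>\<close>.  Since \<open>a\<close> is non-decreasing, a squared norm of at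
  most \<open>R\<^sup>2 a\<^sub>D\<^sup>-\<^sup>2\<close> keeps the signal in the ellipsoid.\<close>

lemma minimax_rate_lower:
  assumes \<beta>: "\<beta> < 1 - \<alpha>" and \<sigma>: "0 < \<sigma>" and b: "\<forall>j\<in>J. 0 < b j"
    and a: "\<forall>k\<in>J. 0 < a k" "mono_on J a" and D: "1 \<le> D"
  shows "ereal (min (rho_sq \<alpha> \<beta> b \<sigma> D) (R\<^sup>2 * inverse ((a D)\<^sup>2)))
           \<le> (minimax_rate b \<sigma> (ellipsoid a R) \<alpha> \<beta>)\<^sup>2"
proof -
  define m where "m = min (rho_sq \<alpha> \<beta> b \<sigma> D) (R\<^sup>2 * inverse ((a D)\<^sup>2))"
  define s where "s = (\<Sum>j=1..D. inverse (b j ^ 4))"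
  define \<eta> where "\<eta> = 1 - \<alpha> - \<beta>"
  have s: "0 < s" unfolding s_def by (rule sum_inverse_pow4_pos[OF b D])
  have m0: "0 \<le> m"
    using c_const_pos[OF \<beta>] s by (auto simp: m_def rho_sq_def s_def)
  have m1: "m \<le> c_const \<alpha> \<beta> * \<sigma>\<^sup>2 * sqrt s" by (simp add: m_def rho_sq_def s_def)
  have bpos: "0 < b j" if "j \<in> {1..D}" for j using that b by auto
  define u where "u j = sqrt m * inverse (b j) / (sqrt s * \<sigma>)" for j
  have u4: "(\<Sum>j=1..D. u j ^ 4) / 2 \<le> ln (1 + 4 * \<eta>\<^sup>2)"
  proof -
    have p4: "sqrt x ^ 4 = x\<^sup>2" if "0 \<le> x" for x
      using that by (metis numeral_Bit0_eq_double power_mult real_sqrt_pow2 mult_2 power_add numeral_Bit0 power2_eq_square)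
    have "(\<Sum>j=1..D. u j ^ 4) = (\<Sum>j=1..D. (m\<^sup>2 / (s\<^sup>2 * \<sigma> ^ 4)) * inverse (b j ^ 4))"
      using m0 s by (intro sum.cong) (auto simp: u_def power_mult_distrib power_divide p4 power_inverse)
    also have "\<dots> = m\<^sup>2 / (s\<^sup>2 * \<sigma> ^ 4) * s"
      unfolding s_def sum_distrib_left ..
    also have "\<dots> = m\<^sup>2 / (s * \<sigma> ^ 4)" using s by (simp add: power2_eq_square)
    also have "\<dots> \<le> (c_const \<alpha> \<beta> * \<sigma>\<^sup>2 * sqrt s)\<^sup>2 / (s * \<sigma> ^ 4)"
      using m0 m1 s \<sigma> by (intro divide_right_mono power_mono) auto
    also have "\<dots> = (c_const \<alpha> \<beta>)\<^sup>2"
      using s \<sigma> by (simp add: power_mult_distrib)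
    also have "\<dots> = 2 * ln (1 + 4 * \<eta>\<^sup>2)"
      by (simp add: c_const_def \<eta>_def)
    finally show ?thesis by simp
  qed
  have "ereal (sqrt m) \<le> minimax_rate b \<sigma> (ellipsoid a R) \<alpha> \<beta>"
  proof (rule minimax_rate_geI)
    fix \<Phi> assume \<Phi>: "\<Phi> \<in> level_tests b \<sigma> \<alpha>"
    then have t: "\<Phi> \<in> tests" and lev: "reject_prob b \<sigma> \<Phi> (\<lambda>_. 0) \<le> \<alpha>"
      by (auto simp: level_tests_def)
    define G where "G = {\<epsilon> \<in> space noise. \<Phi> (Y b \<sigma> (\<lambda>_. 0) \<epsilon>) = 1}"
    have "Y b \<sigma> (\<lambda>_. 0) -` {y \<in> space obs_space. \<Phi> y = 1} \<inter> space noise \<in> sets noise"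
      using reject_prob_eq(2)[OF t] by (rule measurable_sets[OF measurable_Y])
    also have "Y b \<sigma> (\<lambda>_. 0) -` {y \<in> space obs_space. \<Phi> y = 1} \<inter> space noise = G"
      using measurable_space[OF measurable_Y] by (auto simp: G_def)
    finally have G: "G \<in> sets noise" .
    obtain \<omega> where \<omega>: "\<omega> \<in> {1..D} \<rightarrow>\<^sub>E {-1, 1}"
      "noise.prob (shift (signed {1..D} u \<omega>) -` G \<inter> space noise)
           \<le> noise.prob G + sqrt (exp ((\<Sum>j=1..D. u j ^ 4) / 2) - 1) / 2"
      using exists_hard_signs[of "{1..D}" G u] G by auto
    define \<theta> where "\<theta> j = signed {1..D} u \<omega> j * \<sigma> * inverse (b j)" for j
    have \<theta>sq: "(\<theta> j)\<^sup>2 = m / s * inverse (b j ^ 4)" if j: "j \<in> {1..D}" for j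
    proof -
      have "(\<omega> j)\<^sup>2 = 1" using PiE_mem[OF \<omega>(1) j] by auto
      then have "(\<theta> j)\<^sup>2 = (sqrt m)\<^sup>2 / (sqrt s)\<^sup>2 * ((inverse (b j))\<^sup>2)\<^sup>2"
        using j \<sigma> by (simp add: \<theta>_def signed_def u_def power_mult_distrib power_divide field_simps)
      also have "\<dots> = m / s * inverse (b j ^ 4)"
        using m0 s by (simp add: power_inverse power_mult[symmetric])
      finally show ?thesis .
    qed
    have \<theta>0: "\<theta> j = 0" if "j \<in> J - {1..D}" for j using that by (auto simp: \<theta>_def signed_def)
    have "(\<Sum>j=1..D. (\<theta> j)\<^sup>2) = (\<Sum>j=1..D. m / s * inverse (b j ^ 4))"
      by (rule sum.cong[OF refl \<theta>sq])
    also have "\<dots> = m / s * s" unfolding s_def sum_distrib_left ..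
    finally have sum\<theta>: "(\<Sum>j=1..D. (\<theta> j)\<^sup>2) = m" using s by simp
    have norm: "(\<lambda>j. (\<theta> j)\<^sup>2) summable_on J" "l2_norm \<theta> = sqrt m"
      using infsum_finite_support[of D "\<lambda>j. (\<theta> j)\<^sup>2"] \<theta>0 sum\<theta> by (simp_all add: l2_norm_def)
    have "(\<Sum>j=1..D. (a j)\<^sup>2 * (\<theta> j)\<^sup>2) \<le> (\<Sum>j=1..D. (a D)\<^sup>2 * (\<theta> j)\<^sup>2)"
    proof (intro sum_mono mult_right_mono power_mono)
      fix j assume j: "j \<in> {1..D}"
      then show "a j \<le> a D" using D by (intro mono_onD[OF a(2)]) auto
      show "0 \<le> a j" using a(1) j by (auto intro: less_imp_le)
    qed auto
    also have "\<dots> = (a D)\<^sup>2 * m" by (simp only: sum_distrib_left[symmetric] sum\<theta>)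
    also have "\<dots> \<le> (a D)\<^sup>2 * (R\<^sup>2 * inverse ((a D)\<^sup>2))"
      by (intro mult_left_mono) (auto simp: m_def)
    also have "\<dots> = R\<^sup>2"
    proof -
      have "0 < a D" using a D by auto
      then show ?thesis by simp
    qed
    finally have "\<theta> \<in> ellipsoid a R"
      using infsum_finite_support[of D "\<lambda>j. (a j)\<^sup>2 * (\<theta> j)\<^sup>2"] \<theta>0 norm
      by (simp add: ellipsoid_def l2_def)
    moreover have "reject_prob b \<sigma> \<Phi> \<theta> \<le> 1 - \<beta>"
    proof -
      have eq: "shift (\<lambda>j. b j * \<theta> j / \<sigma>) = shift (signed {1..D} u \<omega>)"
        unfolding shift_def
      proof (rule ext, rule restrict_ext)
        fix \<epsilon> j assume "j \<in> J"
        then have "0 < b j" using b by blast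
        then show "\<epsilon> j + b j * \<theta> j / \<sigma> = \<epsilon> j + signed {1..D} u \<omega> j"
          using \<sigma> by (simp add: \<theta>_def)
      qed
      have "{\<epsilon> \<in> space noise. \<Phi> (Y b \<sigma> \<theta> \<epsilon>) = 1} = shift (signed {1..D} u \<omega>) -` G \<inter> space noise"
        using measurable_space[OF measurable_shift]
        by (auto simp: G_def Y_shift[OF \<sigma>, of b \<theta>] eq)
      then have "reject_prob b \<sigma> \<Phi> \<theta> = noise.prob (shift (signed {1..D} u \<omega>) -` G \<inter> space noise)"
        by (simp add: reject_prob_eq(1)[OF t])
      also have "\<dots> \<le> \<alpha> + sqrt (exp ((\<Sum>j=1..D. u j ^ 4) / 2) - 1) / 2"
        using \<omega>(2) lev by (simp add: reject_prob_eq(1)[OF t] G_def)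
      also have "exp ((\<Sum>j=1..D. u j ^ 4) / 2) \<le> 1 + 4 * \<eta>\<^sup>2"
      proof -
        have "exp ((\<Sum>j=1..D. u j ^ 4) / 2) \<le> exp (ln (1 + 4 * \<eta>\<^sup>2))" using u4 by simp
        also have "\<dots> = 1 + 4 * \<eta>\<^sup>2" by (rule exp_ln) (simp add: add_pos_nonneg)
        finally show ?thesis .
      qed
      also have "sqrt (1 + 4 * \<eta>\<^sup>2 - 1) = 2 * \<eta>"
        using \<beta> by (simp add: real_sqrt_mult \<eta>_def)
      finally show ?thesis by (simp add: \<eta>_def diff_divide_distrib)
    qed
    ultimately show "\<exists>\<theta>\<in>ellipsoid a R. sqrt m \<le> l2_norm \<theta> \<and> reject_prob b \<sigma> \<Phi> \<theta> \<le> 1 - \<beta>"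
      using norm by (intro bexI[of _ \<theta>]) auto
  qed
  then have "(ereal (sqrt m))\<^sup>2 \<le> (minimax_rate b \<sigma> (ellipsoid a R) \<alpha> \<beta>)\<^sup>2"
    using m0 by (intro ereal_power2_mono) auto
  then show ?thesis using m0 by (simp add: m_def)
qed

section \<open>The upper bound\<close>

text \<open>Chebyshev: centred functions of distinct coordinates are orthogonal, so the variances add up.\<close>

lemma (in product_prob_space) sum_centred_coordinates_deviation:
  fixes \<xi> :: "'i \<Rightarrow> 'a \<Rightarrow> real"
  assumes K: "finite K" "K \<subseteq> I"
    and [measurable]: "\<And>i. i \<in> K \<Longrightarrow> \<xi> i \<in> borel_measurable (M i)"
    and sq: "\<And>i. i \<in> K \<Longrightarrow> integrable (M i) (\<lambda>x. (\<xi> i x)\<^sup>2)"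
    and centred: "\<And>i. i \<in> K \<Longrightarrow> integral\<^sup>L (M i) (\<xi> i) = 0"
    and t: "0 < t"
  shows "P.prob {x \<in> space (PiM I M). t \<le> \<bar>\<Sum>i\<in>K. \<xi> i (x i)\<bar>}
           \<le> (\<Sum>i\<in>K. \<integral>x. (\<xi> i x)\<^sup>2 \<partial>M i) / t\<^sup>2"
proof -
  let ?X = "\<lambda>x. \<Sum>i\<in>K. \<xi> i (x i)"
  have int: "integrable (M i) (\<xi> i)" if "i \<in> K" for i
    using that by (intro M.square_integrable_imp_integrable[OF _ sq]) auto
  have coord: "integrable (PiM I M) (\<lambda>x. g (x i))" "(\<integral>x. g (x i) \<partial>PiM I M) = integral\<^sup>L (M i) g"
    if "i \<in> K" "integrable (M i) g" for i and g :: "'a \<Rightarrow> real"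
    using integrable_prod_coordinates[of "{i}" "\<lambda>_. g"] integral_prod_coordinates[of "{i}" "\<lambda>_. g"] that K
    by auto
  have pair: "integrable (PiM I M) (\<lambda>x. \<xi> i (x i) * \<xi> j (x j)) \<and>
      (\<integral>x. \<xi> i (x i) * \<xi> j (x j) \<partial>PiM I M) = (if i = j then \<integral>x. (\<xi> i x)\<^sup>2 \<partial>M i else 0)"
    if "i \<in> K" "j \<in> K" for i j
  proof (cases "i = j")
    case True
    then show ?thesis using coord[OF that(1) sq[OF that(1)]] by (simp add: power2_eq_square)
  next
    case False
    then show ?thesis
      using integrable_prod_coordinates[of "{i, j}" \<xi>] integral_prod_coordinates[of "{i, j}" \<xi>] that K int centred
      by auto
  qed
  have X2: "(\<lambda>x. (?X x)\<^sup>2) = (\<lambda>x. \<Sum>i\<in>K. \<Sum>j\<in>K. \<xi> i (x i) * \<xi> j (x j))"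
    by (simp add: power2_eq_square sum_product)
  have i2: "integrable (PiM I M) (\<lambda>x. (?X x)\<^sup>2)"
    unfolding X2 using pair by (intro Bochner_Integration.integrable_sum) auto
  have "P.expectation (\<lambda>x. (?X x)\<^sup>2) = (\<Sum>i\<in>K. \<Sum>j\<in>K. \<integral>x. \<xi> i (x i) * \<xi> j (x j) \<partial>PiM I M)"
    unfolding X2 using pair
    by (simp add: Bochner_Integration.integral_sum Bochner_Integration.integrable_sum)
  also have "\<dots> = (\<Sum>i\<in>K. \<Sum>j\<in>K. if i = j then \<integral>x. (\<xi> i x)\<^sup>2 \<partial>M i else 0)"
    using pair by (intro sum.cong refl) auto
  also have "\<dots> = (\<Sum>i\<in>K. \<integral>x. (\<xi> i x)\<^sup>2 \<partial>M i)"
    using K by (simp add: sum.delta)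
  finally have E2: "P.expectation (\<lambda>x. (?X x)\<^sup>2) = (\<Sum>i\<in>K. \<integral>x. (\<xi> i x)\<^sup>2 \<partial>M i)" .
  have m: "?X \<in> borel_measurable (PiM I M)"
    using coord(1)[OF _ int] by (intro borel_measurable_sum) auto
  have E1: "P.expectation ?X = 0"
    using coord[OF _ int] centred by (simp add: Bochner_Integration.integral_sum)
  show ?thesis
    using P.Chebyshev_inequality[OF m i2 t] E1 E2 by simp
qed

text \<open>The fluctuation of \<open>\<Sum>(\<theta>\<^sub>j + v\<^sub>j \<epsilon>\<^sub>j)\<^sup>2\<close> around its mean.\<close>

lemma quadratic_noise_deviation:
  assumes D: "finite D" "D \<subseteq> J" and t: "0 < t"
  shows "noise.prob {\<epsilon> \<in> space noise. t \<le> \<bar>\<Sum>j\<in>D. 2 * \<theta> j * v j * \<epsilon> j + (v j)\<^sup>2 * ((\<epsilon> j)\<^sup>2 - 1)\<bar>}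
           \<le> (\<Sum>j\<in>D. 2 * v j ^ 4 + 4 * (\<theta> j)\<^sup>2 * (v j)\<^sup>2) / t\<^sup>2"
proof -
  have mom: "has_bochner_integral N (\<lambda>x. x) 0" "has_bochner_integral N (\<lambda>x. x\<^sup>2) 1"
    "has_bochner_integral N (\<lambda>x. x ^ 3) 0" "has_bochner_integral N (\<lambda>x. x ^ 4) 3"
    using integrable_std_normal_distribution_moment[of 1] integral_std_normal_distribution_moment_odd[of 1]
      integrable_std_normal_distribution_moment[of 2] std_normal_distribution_even_moments(1)[of 1]
      integrable_std_normal_distribution_moment[of 3] integral_std_normal_distribution_moment_odd[of 3]
      integrable_std_normal_distribution_moment[of 4] std_normal_distribution_even_moments(1)[of 2]
    by (simp_all add: has_bochner_integral_iff fact_numeral)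
  have one: "has_bochner_integral N (\<lambda>x. c) c" for c :: real
    using N.prob_space by (simp add: has_bochner_integral_iff)
  define \<xi> where "\<xi> j x = 2 * \<theta> j * v j * x + (v j)\<^sup>2 * (x\<^sup>2 - 1)" for j x
  have 1: "has_bochner_integral N (\<xi> j) 0" for j
  proof -
    have "has_bochner_integral N (\<xi> j) (2 * \<theta> j * v j * 0 + (v j)\<^sup>2 * (1 - 1))"
      unfolding \<xi>_def[abs_def]
      by (intro has_bochner_integral_add has_bochner_integral_mult_right has_bochner_integral_diff mom one)
    then show ?thesis by simp
  qed
  have 2: "has_bochner_integral N (\<lambda>x. (\<xi> j x)\<^sup>2) (2 * v j ^ 4 + 4 * (\<theta> j)\<^sup>2 * (v j)\<^sup>2)" for j
  proof -
    let ?c = "4 * (\<theta> j)\<^sup>2 * (v j)\<^sup>2 - 2 * v j ^ 4"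
    have eq: "(\<lambda>x. (\<xi> j x)\<^sup>2) = (\<lambda>x. v j ^ 4 * x ^ 4 + 4 * \<theta> j * v j ^ 3 * x ^ 3
      + ?c * x\<^sup>2 + (- 4 * \<theta> j * v j ^ 3) * x + v j ^ 4)"
      by (simp add: \<xi>_def fun_eq_iff power2_eq_square power3_eq_cube power4_eq_xxxx algebra_simps)
    have "has_bochner_integral N (\<lambda>x. (\<xi> j x)\<^sup>2) (v j ^ 4 * 3 + 4 * \<theta> j * v j ^ 3 * 0
      + ?c * 1 + (- 4 * \<theta> j * v j ^ 3) * 0 + v j ^ 4)"
      unfolding eq
      by (intro has_bochner_integral_add has_bochner_integral_mult_right mom one)
    then show ?thesis by simp
  qed
  show ?thesis
    using coords.sum_centred_coordinates_deviation[OF D, of \<xi> t] 1 2 t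
    by (simp add: has_bochner_integral_iff \<xi>_def noise_def borel_measurable_integrable)
qed

text \<open>The statistic is the unbiased estimator of \<open>\<Sum>\<theta>\<^sub>j\<^sup>2\<close> over the first \<open>D\<close> coordinates.\<close>

definition chi_square_test :: "(nat \<Rightarrow> real) \<Rightarrow> real \<Rightarrow> real \<Rightarrow> nat \<Rightarrow> (nat \<Rightarrow> real) \<Rightarrow> nat" where
  "chi_square_test b \<sigma> q D y =
     (if q < (\<Sum>j=1..D. (y j)\<^sup>2 - (\<sigma> * inverse (b j))\<^sup>2) then 1 else 0)"

lemma chi_square_test_in_tests: "chi_square_test b \<sigma> q D \<in> tests"
proof -
  have [measurable]: "(\<lambda>y. y j) \<in> borel_measurable obs_space" if "j \<in> {1..D}" for j
  proof -
    from that have "j \<in> J" by auto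
    then show ?thesis unfolding obs_space_def by measurable
  qed
  have "chi_square_test b \<sigma> q D \<in> obs_space \<rightarrow>\<^sub>M count_space UNIV"
    unfolding chi_square_test_def by measurable
  then show ?thesis
    unfolding tests_def
    by (rule measurable_count_space_extend[rotated -1]) (auto simp: chi_square_test_def)
qed

lemma chi_square_statistic:
  assumes b: "\<forall>j\<in>J. 0 < b j"
  shows "(\<Sum>j=1..D. (Y b \<sigma> \<theta> \<epsilon> j)\<^sup>2 - (\<sigma> * inverse (b j))\<^sup>2)
       = (\<Sum>j=1..D. (\<theta> j)\<^sup>2) + (\<Sum>j=1..D. 2 * \<theta> j * (\<sigma> * inverse (b j)) * \<epsilon> j
            + (\<sigma> * inverse (b j))\<^sup>2 * ((\<epsilon> j)\<^sup>2 - 1))"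
  unfolding sum.distrib[symmetric]
proof (rule sum.cong[OF refl])
  fix j assume "j \<in> {1..D}"
  then have "0 < b j" "j \<in> J" using b by auto
  then have "Y b \<sigma> \<theta> \<epsilon> j = \<theta> j + \<sigma> * inverse (b j) * \<epsilon> j"
    by (simp add: Y_eq distrib_left)
  then show "(Y b \<sigma> \<theta> \<epsilon> j)\<^sup>2 - (\<sigma> * inverse (b j))\<^sup>2 = (\<theta> j)\<^sup>2 + (2 * \<theta> j * (\<sigma> * inverse (b j)) * \<epsilon> j
            + (\<sigma> * inverse (b j))\<^sup>2 * ((\<epsilon> j)\<^sup>2 - 1))"
    by (simp add: power2_sum power_mult_distrib algebra_simps)
qed

text \<open>Beyond \<open>D\<close> the weights are at least \<open>a\<^sub>D\<^sub>+\<^sub>1\<close>, so the ellipsoid condition bounds the tail.\<close>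

lemma ellipsoid_truncation:
  assumes \<theta>: "\<theta> \<in> ellipsoid a R" and a: "\<forall>k\<in>J. 0 < a k" "mono_on J a"
  shows "(l2_norm \<theta>)\<^sup>2 \<le> (\<Sum>j=1..D. (\<theta> j)\<^sup>2) + R\<^sup>2 * inverse ((a (Suc D))\<^sup>2)"
proof -
  let ?T = "{Suc D..}"
  have J: "J = {1..D} \<union> ?T" "{1..D} \<inter> ?T = {}" by auto
  have sm: "(\<lambda>j. (\<theta> j)\<^sup>2) summable_on J" "(\<lambda>j. (a j)\<^sup>2 * (\<theta> j)\<^sup>2) summable_on J"
    "(\<Sum>\<^sub>\<infinity>j\<in>J. (a j)\<^sup>2 * (\<theta> j)\<^sup>2) \<le> R\<^sup>2"
    using \<theta> by (auto simp: ellipsoid_def l2_def)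
  have smT: "(\<lambda>j. (\<theta> j)\<^sup>2) summable_on ?T" "(\<lambda>j. (a j)\<^sup>2 * (\<theta> j)\<^sup>2) summable_on ?T"
    using sm by (auto intro: summable_on_subset_banach)
  have aD: "0 < a (Suc D)" using a by auto
  have "(\<Sum>\<^sub>\<infinity>j\<in>?T. (\<theta> j)\<^sup>2) \<le> (\<Sum>\<^sub>\<infinity>j\<in>?T. inverse ((a (Suc D))\<^sup>2) * ((a j)\<^sup>2 * (\<theta> j)\<^sup>2))"
  proof (rule infsum_mono)
    fix j assume j: "j \<in> ?T"
    then have "a (Suc D) \<le> a j" by (intro mono_onD[OF a(2)]) auto
    then have "(a (Suc D))\<^sup>2 \<le> (a j)\<^sup>2" using aD by (intro power_mono) auto
    then have "(a (Suc D))\<^sup>2 * (\<theta> j)\<^sup>2 \<le> (a j)\<^sup>2 * (\<theta> j)\<^sup>2" by (intro mult_right_mono) auto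
    then show "(\<theta> j)\<^sup>2 \<le> inverse ((a (Suc D))\<^sup>2) * ((a j)\<^sup>2 * (\<theta> j)\<^sup>2)"
      using aD by (simp add: field_simps)
  qed (use smT in \<open>auto intro: summable_on_cmult_right\<close>)
  also have "\<dots> = inverse ((a (Suc D))\<^sup>2) * (\<Sum>\<^sub>\<infinity>j\<in>?T. (a j)\<^sup>2 * (\<theta> j)\<^sup>2)"
    by (rule infsum_cmult_right')
  also have "(\<Sum>\<^sub>\<infinity>j\<in>?T. (a j)\<^sup>2 * (\<theta> j)\<^sup>2) \<le> (\<Sum>\<^sub>\<infinity>j\<in>J. (a j)\<^sup>2 * (\<theta> j)\<^sup>2)"
    using sm smT by (intro infsum_mono_neutral) auto
  also note sm(3)
  finally have "(\<Sum>\<^sub>\<infinity>j\<in>?T. (\<theta> j)\<^sup>2) \<le> R\<^sup>2 * inverse ((a (Suc D))\<^sup>2)"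
    by (simp add: mult.commute mult_right_mono)
  moreover have "(\<Sum>\<^sub>\<infinity>j\<in>J. (\<theta> j)\<^sup>2) = (\<Sum>j=1..D. (\<theta> j)\<^sup>2) + (\<Sum>\<^sub>\<infinity>j\<in>?T. (\<theta> j)\<^sup>2)"
    using infsum_Un_disjoint[of "\<lambda>j. (\<theta> j)\<^sup>2" "{1..D}" ?T] smT by (subst J(1)) auto
  moreover have "(l2_norm \<theta>)\<^sup>2 = (\<Sum>\<^sub>\<infinity>j\<in>J. (\<theta> j)\<^sup>2)"
    unfolding l2_norm_def by (rule real_sqrt_pow2) (auto intro: infsum_nonneg)
  ultimately show ?thesis by simp
qed

text \<open>With \<open>K\<close> standing for this constant, the power bound requires \<open>24 / K < \<beta>\<close> strictly (the first entry),
  \<open>1 \<le> K\<close> to absorb \<open>1 / K\<^sup>2\<close> into \<open>1 / K\<close>, and a critical value of at most half the energy \<open>K * S\<close>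
  (the third entry).\<close>

definition upper_const :: "real \<Rightarrow> real \<Rightarrow> real" where
  "upper_const \<alpha> \<beta> = max (25 / \<beta>) (max 1 (2 * sqrt (2 / \<alpha>)))"

text \<open>Both errors come from \<open>quadratic_noise_deviation\<close>.  The variance of the statistic is
  \<open>2 S\<^sup>2 + 4 \<Sum>\<theta>\<^sub>j\<^sup>2 \<sigma>\<^sub>j\<^sup>2\<close>, and \<open>\<sigma>\<^sub>j\<^sup>2 \<le> S\<close> bounds the second term by \<open>4 m S\<close> with \<open>m = \<Sum>\<theta>\<^sub>j\<^sup>2\<close>; once
  \<open>m\<close> is a large multiple of \<open>S\<close> this is small compared with \<open>m\<^sup>2\<close>.  The loss \<open>24/25\<close> leaves room for
  the strict inequality in the definition of the rate.\<close>

lemma chi_square_test_properties: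
  fixes \<sigma> :: real and D :: nat
  assumes \<alpha>: "0 < \<alpha>" and \<beta>: "0 < \<beta>" and \<sigma>: "0 < \<sigma>" and b: "\<forall>j\<in>J. 0 < b j"
  defines "S \<equiv> \<sigma>\<^sup>2 * sqrt (\<Sum>j=1..D. inverse (b j ^ 4))"
  defines "\<Phi> \<equiv> chi_square_test b \<sigma> (sqrt (2 / \<alpha>) * S) D"
  shows "reject_prob b \<sigma> \<Phi> (\<lambda>_. 0) \<le> \<alpha>"
    and "\<lbrakk>0 < (\<Sum>j=1..D. (\<theta> j)\<^sup>2); upper_const \<alpha> \<beta> * S \<le> (\<Sum>j=1..D. (\<theta> j)\<^sup>2)\<rbrakk>
           \<Longrightarrow> 1 - 24 / 25 * \<beta> \<le> reject_prob b \<sigma> \<Phi> \<theta>"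
proof -
  define v where "v j = \<sigma> * inverse (b j)" for j
  define X where "X \<theta> \<epsilon> = (\<Sum>j=1..D. 2 * \<theta> j * v j * \<epsilon> j + (v j)\<^sup>2 * ((\<epsilon> j)\<^sup>2 - 1))" for \<theta> \<epsilon> :: "nat \<Rightarrow> real"
  define q where "q = sqrt (2 / \<alpha>) * S"
  have t: "\<Phi> \<in> tests" unfolding \<Phi>_def by (rule chi_square_test_in_tests)
  have S0: "0 \<le> S" unfolding S_def by (intro mult_nonneg_nonneg real_sqrt_ge_zero sum_nonneg) auto
  have S2: "S\<^sup>2 = (\<Sum>j=1..D. v j ^ 4)"
  proof -
    have "S\<^sup>2 = \<sigma> ^ 4 * (\<Sum>j=1..D. inverse (b j ^ 4))"
      unfolding S_def power_mult_distrib by (subst real_sqrt_pow2) (auto intro: sum_nonneg)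
    then show ?thesis
      by (simp add: v_def sum_distrib_left power_mult_distrib power_inverse)
  qed
  have rej: "\<Phi> (Y b \<sigma> \<theta> \<epsilon>) = (if q < (\<Sum>j=1..D. (\<theta> j)\<^sup>2) + X \<theta> \<epsilon> then 1 else 0)" for \<theta> \<epsilon>
    unfolding \<Phi>_def chi_square_test_def q_def X_def v_def chi_square_statistic[OF b] ..
  have rp: "reject_prob b \<sigma> \<Phi> \<theta> = noise.prob {\<epsilon> \<in> space noise. q < (\<Sum>j=1..D. (\<theta> j)\<^sup>2) + X \<theta> \<epsilon>}" for \<theta>
    unfolding reject_prob_eq(1)[OF t] by (auto simp: rej intro!: arg_cong[where f=noise.prob])
  have dev: "noise.prob {\<epsilon> \<in> space noise. t \<le> \<bar>X \<theta> \<epsilon>\<bar>} \<le> (\<Sum>j=1..D. 2 * v j ^ 4 + 4 * (\<theta> j)\<^sup>2 * (v j)\<^sup>2) / t\<^sup>2"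
    if "0 < t" for t \<theta>
    unfolding X_def by (rule quadratic_noise_deviation) (use that in auto)
  have [measurable]: "(\<lambda>\<epsilon>. \<epsilon> j) \<in> borel_measurable noise" if "j \<in> {1..D}" for j
  proof -
    from that have "j \<in> J" by auto
    then show ?thesis unfolding noise_def by measurable
  qed
  have mX[measurable]: "X \<theta> \<in> borel_measurable noise" for \<theta>
    unfolding X_def by measurable
  show "reject_prob b \<sigma> \<Phi> (\<lambda>_. 0) \<le> \<alpha>"
  proof (cases "D = 0")
    case True
    then show ?thesis using \<alpha> unfolding rp by (simp add: X_def q_def S_def)
  next
    case False
    then have "0 < S"
      unfolding S_def using sum_inverse_pow4_pos[OF b, of D] \<sigma> by simp
    then have q0: "0 < q" and q2: "q\<^sup>2 = 2 / \<alpha> * S\<^sup>2" using \<alpha> by (auto simp: q_def power_mult_distrib)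
    have "reject_prob b \<sigma> \<Phi> (\<lambda>_. 0) \<le> noise.prob {\<epsilon> \<in> space noise. q \<le> \<bar>X (\<lambda>_. 0) \<epsilon>\<bar>}"
      unfolding rp by (rule noise.finite_measure_mono) auto
    also have "\<dots> \<le> 2 * S\<^sup>2 / q\<^sup>2"
      using dev[OF q0, of "\<lambda>_. 0"] by (simp add: S2 sum_distrib_left)
    also have "\<dots> = \<alpha>" using \<open>0 < S\<close> \<alpha> by (simp add: q2)
    finally show ?thesis .
  qed
  define K where "K = upper_const \<alpha> \<beta>"
  have K: "1 \<le> K" "25 / \<beta> \<le> K" "2 * sqrt (2 / \<alpha>) \<le> K" by (auto simp: K_def upper_const_def)
  define m where "m = (\<Sum>j=1..D. (\<theta> j)\<^sup>2)"
  assume "0 < (\<Sum>j=1..D. (\<theta> j)\<^sup>2)" "upper_const \<alpha> \<beta> * S \<le> (\<Sum>j=1..D. (\<theta> j)\<^sup>2)"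
  then have m: "0 < m" "K * S \<le> m" by (simp_all add: m_def K_def)
  have "2 * sqrt (2 / \<alpha>) * S \<le> K * S" by (rule mult_right_mono[OF K(3) S0])
  then have qm: "q \<le> m / 2" using m by (simp add: q_def)
  have Sm: "S \<le> m / K" using m K by (simp add: field_simps)
  have "(\<Sum>j=1..D. (\<theta> j)\<^sup>2 * (v j)\<^sup>2) \<le> (\<Sum>j=1..D. (\<theta> j)\<^sup>2 * S)"
  proof (intro sum_mono mult_left_mono)
    fix j assume j: "j \<in> {1..D}"
    have "((v j)\<^sup>2)\<^sup>2 = v j ^ 4" by simp
    also have "\<dots> \<le> (\<Sum>j=1..D. v j ^ 4)" using j by (intro member_le_sum) auto
    finally show "(v j)\<^sup>2 \<le> S" using S0 unfolding S2[symmetric] by (rule power2_le_imp_le)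
  qed auto
  then have vs: "(\<Sum>j=1..D. (\<theta> j)\<^sup>2 * (v j)\<^sup>2) \<le> m * S" by (simp add: m_def sum_distrib_right)
  have "(\<Sum>j=1..D. 2 * v j ^ 4 + 4 * (\<theta> j)\<^sup>2 * (v j)\<^sup>2) = 2 * S\<^sup>2 + 4 * (\<Sum>j=1..D. (\<theta> j)\<^sup>2 * (v j)\<^sup>2)"
    by (simp add: S2 sum.distrib sum_distrib_left mult.assoc)
  also have "\<dots> \<le> 2 * (m * (m / K)) + 4 * (m * (m / K))"
  proof -
    have "S \<le> m"
      using Sm K m by (smt (verit, best) divide_le_eq mult_less_cancel_left2)
    then have "S\<^sup>2 \<le> m * (m / K)"
      unfolding power2_eq_square using Sm S0 m by (intro mult_mono) auto
    moreover have "m * S \<le> m * (m / K)" using Sm m by (intro mult_left_mono) auto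
    ultimately show ?thesis using vs by linarith
  qed
  also have "\<dots> = 6 * m\<^sup>2 / K" by (simp add: power2_eq_square)
  finally have "(\<Sum>j=1..D. 2 * v j ^ 4 + 4 * (\<theta> j)\<^sup>2 * (v j)\<^sup>2) / (m / 2)\<^sup>2 \<le> (6 * m\<^sup>2 / K) / (m / 2)\<^sup>2"
    by (rule divide_right_mono) simp
  then have "noise.prob {\<epsilon> \<in> space noise. m / 2 \<le> \<bar>X \<theta> \<epsilon>\<bar>} \<le> (6 * m\<^sup>2 / K) / (m / 2)\<^sup>2"
    using dev[of "m / 2" \<theta>] m by linarith
  also have "\<dots> = 24 / K" using m by (simp add: field_simps power2_eq_square)
  also have "\<dots> \<le> 24 / 25 * \<beta>"
    using K \<beta> by (simp add: field_simps)
  finally have small: "noise.prob {\<epsilon> \<in> space noise. m / 2 \<le> \<bar>X \<theta> \<epsilon>\<bar>} \<le> 24 / 25 * \<beta>" .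
  have "1 - reject_prob b \<sigma> \<Phi> \<theta> = noise.prob {\<epsilon> \<in> space noise. \<not> q < m + X \<theta> \<epsilon>}"
    unfolding rp m_def[symmetric] by (subst noise.prob_neg) auto
  also have "\<dots> \<le> noise.prob {\<epsilon> \<in> space noise. m / 2 \<le> \<bar>X \<theta> \<epsilon>\<bar>}"
    using qm by (intro noise.finite_measure_mono) auto
  also note small
  finally show "1 - 24 / 25 * \<beta> \<le> reject_prob b \<sigma> \<Phi> \<theta>" by simp
qed

lemma minimax_rate_nonneg: "0 \<le> minimax_rate b \<sigma> F \<alpha> \<beta>"
  unfolding minimax_rate_def test_rate_def
  by (rule INF_greatest, rule Inf_greatest) auto

lemma minimax_rate_upper:
  assumes \<alpha>: "0 < \<alpha>" and \<beta>: "0 < \<beta>" and \<sigma>: "0 < \<sigma>" and b: "\<forall>j\<in>J. 0 < b j"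
    and a: "\<forall>k\<in>J. 0 < a k" "mono_on J a"
  shows "(minimax_rate b \<sigma> (ellipsoid a R) \<alpha> \<beta>)\<^sup>2
    \<le> ereal (upper_const \<alpha> \<beta> * (\<sigma>\<^sup>2 * sqrt (\<Sum>j=1..D. inverse (b j ^ 4))) + R\<^sup>2 * inverse ((a (Suc D))\<^sup>2))"
proof -
  define S where "S = \<sigma>\<^sup>2 * sqrt (\<Sum>j=1..D. inverse (b j ^ 4))"
  define \<Phi> where "\<Phi> = chi_square_test b \<sigma> (sqrt (2 / \<alpha>) * S) D"
  define m where "m = upper_const \<alpha> \<beta> * S + R\<^sup>2 * inverse ((a (Suc D))\<^sup>2)"
  have S0: "0 \<le> S" unfolding S_def by (intro mult_nonneg_nonneg real_sqrt_ge_zero sum_nonneg) auto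
  have uS: "0 \<le> upper_const \<alpha> \<beta> * S" using S0 by (simp add: upper_const_def)
  have m0: "0 \<le> m" using uS by (simp add: m_def)
  have lev: "\<Phi> \<in> level_tests b \<sigma> \<alpha>"
    using chi_square_test_properties(1)[OF \<alpha> \<beta> \<sigma> b] chi_square_test_in_tests
    by (auto simp: level_tests_def \<Phi>_def S_def)
  have "minimax_rate b \<sigma> (ellipsoid a R) \<alpha> \<beta> \<le> ereal (sqrt m)"
  \<comment> \<open>The radius is approached from above: at \<open>sqrt m\<close> itself the energy in the first \<open>D\<close> coordinates may
      vanish when \<open>D = 0\<close>, and then the test has no power.\<close>
  proof (rule ereal_le_epsilon2)
    fix e :: real assume e: "0 < e"
    define \<rho> where "\<rho> = sqrt m + e"
    have \<rho>: "0 < \<rho>" using e m0 by (simp add: \<rho>_def add_nonneg_pos)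
    have "(sqrt m)\<^sup>2 < \<rho>\<^sup>2" using e m0 by (intro power_strict_mono) (auto simp: \<rho>_def)
    then have \<rho>m: "m < \<rho>\<^sup>2" using m0 by simp
    have "ereal (1 - \<beta>) < ereal (1 - 24 / 25 * \<beta>)" using \<beta> by simp
    also have "\<dots> \<le> (INF \<theta>\<in>{\<theta> \<in> ellipsoid a R. l2_norm \<theta> \<ge> \<rho>}. ereal (reject_prob b \<sigma> \<Phi> \<theta>))"
    proof (rule INF_greatest)
      fix \<theta> assume "\<theta> \<in> {\<theta> \<in> ellipsoid a R. l2_norm \<theta> \<ge> \<rho>}"
      then have \<theta>: "\<theta> \<in> ellipsoid a R" "\<rho> \<le> l2_norm \<theta>" by auto
      have "\<rho>\<^sup>2 \<le> (l2_norm \<theta>)\<^sup>2" using \<theta> \<rho> by (intro power_mono) auto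
      also have "\<dots> \<le> (\<Sum>j=1..D. (\<theta> j)\<^sup>2) + R\<^sup>2 * inverse ((a (Suc D))\<^sup>2)"
        by (rule ellipsoid_truncation[OF \<theta>(1) a])
      finally have "upper_const \<alpha> \<beta> * S < (\<Sum>j=1..D. (\<theta> j)\<^sup>2)" using \<rho>m by (simp add: m_def)
      with uS have "1 - 24 / 25 * \<beta> \<le> reject_prob b \<sigma> \<Phi> \<theta>"
        unfolding \<Phi>_def S_def by (intro chi_square_test_properties(2)[OF \<alpha> \<beta> \<sigma> b]) auto
      then show "ereal (1 - 24 / 25 * \<beta>) \<le> ereal (reject_prob b \<sigma> \<Phi> \<theta>)" by simp
    qed
    finally have "test_rate b \<sigma> \<Phi> (ellipsoid a R) \<beta> \<le> ereal \<rho>"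
      unfolding test_rate_def using \<rho> by (intro Inf_lower) auto
    moreover have "minimax_rate b \<sigma> (ellipsoid a R) \<alpha> \<beta> \<le> test_rate b \<sigma> \<Phi> (ellipsoid a R) \<beta>"
      unfolding minimax_rate_def by (rule INF_lower[OF lev])
    ultimately show "minimax_rate b \<sigma> (ellipsoid a R) \<alpha> \<beta> \<le> ereal (sqrt m) + ereal e"
      by (simp add: \<rho>_def)
  qed
  then have "(minimax_rate b \<sigma> (ellipsoid a R) \<alpha> \<beta>)\<^sup>2 \<le> (ereal (sqrt m))\<^sup>2"
    by (intro ereal_power2_mono minimax_rate_nonneg)
  then show ?thesis using m0 by (simp add: m_def S_def)
qed

section \<open>Asymptotics of weights and noise levels\<close>

text \<open>From \<open>ln z \<le> z - 1\<close> at \<open>z = c x / k\<close>, the maximum being attained at \<open>z = 1\<close>.\<close>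

lemma powr_mult_exp_bounded:
  fixes k c :: real
  assumes "0 < k" "0 < c"
  obtains M where "0 < M" "\<And>x. 0 < x \<Longrightarrow> x powr k * exp (- c * x) \<le> M"
proof
  show "0 < exp (k * (ln (k / c) - 1))" by simp
  fix x :: real assume x: "0 < x"
  have "ln (c * x / k) \<le> c * x / k - 1"
    using assms x by (intro ln_le_minus_one) simp
  then have "ln x \<le> c * x / k - 1 + ln (k / c)"
    using assms x by (simp add: ln_mult ln_div)
  then have "k * ln x \<le> k * (c * x / k - 1 + ln (k / c))"
    using assms by (intro mult_left_mono) auto
  then have "k * ln x - c * x \<le> k * (ln (k / c) - 1)"
    using assms by (simp add: algebra_simps)
  then show "x powr k * exp (- c * x) \<le> exp (k * (ln (k / c) - 1))"
    using x by (simp add: powr_def mult_exp_exp)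
qed

lemma same_order_inverse_squareE:
  assumes "a \<simeq> w" and w: "\<forall>k\<ge>1. 0 < w k"
  obtains c\<^sub>1 c\<^sub>2 :: real where "0 < c\<^sub>1" "0 < c\<^sub>2"
    "\<And>k. 1 \<le> k \<Longrightarrow> c\<^sub>1 * inverse ((w k)\<^sup>2) \<le> inverse ((a k)\<^sup>2)"
    "\<And>k. 1 \<le> k \<Longrightarrow> inverse ((a k)\<^sup>2) \<le> c\<^sub>2 * inverse ((w k)\<^sup>2)"
proof -
  obtain d\<^sub>1 d\<^sub>2 where d: "0 < d\<^sub>1" "0 < d\<^sub>2" "\<And>k. 1 \<le> k \<Longrightarrow> d\<^sub>1 * w k \<le> a k \<and> a k \<le> d\<^sub>2 * w k"
    using assms(1) unfolding same_order_def by blast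
  show thesis
  proof
    show "0 < inverse (d\<^sub>2\<^sup>2)" "0 < inverse (d\<^sub>1\<^sup>2)" using d by auto
    fix k :: nat assume k: "1 \<le> k"
    have p: "0 < d\<^sub>1 * w k" "d\<^sub>1 * w k \<le> a k" "a k \<le> d\<^sub>2 * w k" "0 < a k"
      using d(3)[OF k] w k d(1) by (auto intro: less_le_trans[of 0 "d\<^sub>1 * w k"])
    have "(d\<^sub>1 * w k)\<^sup>2 \<le> (a k)\<^sup>2" "(a k)\<^sup>2 \<le> (d\<^sub>2 * w k)\<^sup>2"
      using p by (auto intro: power_mono)
    then have "inverse ((a k)\<^sup>2) \<le> inverse ((d\<^sub>1 * w k)\<^sup>2)" "inverse ((d\<^sub>2 * w k)\<^sup>2) \<le> inverse ((a k)\<^sup>2)"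
      using p by (auto intro!: le_imp_inverse_le)
    then show "inverse (d\<^sub>2\<^sup>2) * inverse ((w k)\<^sup>2) \<le> inverse ((a k)\<^sup>2)"
      "inverse ((a k)\<^sup>2) \<le> inverse (d\<^sub>1\<^sup>2) * inverse ((w k)\<^sup>2)"
      by (simp_all add: power_mult_distrib)
  qed
qed

lemma powr_square: "(x powr c)\<^sup>2 = (x powr (2 * c) :: real)"
  by (simp add: power2_eq_square powr_add[symmetric])

lemma inverse_square_powr: "inverse ((x powr c)\<^sup>2) = (x powr (- 2 * c) :: real)"
  by (simp add: powr_square powr_minus[symmetric])

lemma inverse_square_exp: "inverse ((exp x)\<^sup>2) = exp (- 2 * x :: real)"
  by (simp add: exp_minus exp_double)

lemma polynomial_weightsE:
  assumes "a \<simeq> (\<lambda>k. real k powr s)"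
  obtains c\<^sub>1 c\<^sub>2 where "0 < c\<^sub>1" "0 < c\<^sub>2"
    "\<And>k. 1 \<le> k \<Longrightarrow> c\<^sub>1 * real k powr (- 2 * s) \<le> inverse ((a k)\<^sup>2)"
    "\<And>k. 1 \<le> k \<Longrightarrow> inverse ((a k)\<^sup>2) \<le> c\<^sub>2 * real k powr (- 2 * s)"
  using same_order_inverse_squareE[OF assms] unfolding inverse_square_powr by auto

lemma exponential_weightsE:
  assumes "a \<simeq> (\<lambda>k. exp (g k))"
  obtains c\<^sub>1 c\<^sub>2 where "0 < c\<^sub>1" "0 < c\<^sub>2"
    "\<And>k. 1 \<le> k \<Longrightarrow> c\<^sub>1 * exp (- 2 * g k) \<le> inverse ((a k)\<^sup>2)"
    "\<And>k. 1 \<le> k \<Longrightarrow> inverse ((a k)\<^sup>2) \<le> c\<^sub>2 * exp (- 2 * g k)"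
  using same_order_inverse_squareE[OF assms] unfolding inverse_square_exp by auto

text \<open>The standard deviation of \<open>\<Sum>\<sigma>\<^sub>j\<^sup>2 \<epsilon>\<^sub>j\<^sup>2\<close> over the first \<open>D\<close> coordinates, up to the factor
  \<open>sqrt 2 * \<sigma>\<^sup>2\<close>.\<close>

definition noise_level :: "(nat \<Rightarrow> real) \<Rightarrow> nat \<Rightarrow> real" where
  "noise_level b D = sqrt (\<Sum>j=1..D. inverse (b j ^ 4))"

lemma noise_level_le:
  assumes "\<And>j. j \<in> {1..D} \<Longrightarrow> inverse ((b j)\<^sup>2) \<le> w"
  shows "noise_level b D \<le> sqrt (real D) * w"
proof (cases "D = 0")
  case False
  then have w: "0 \<le> w" using assms[of 1] by (auto intro: order_trans[of 0 "inverse ((b 1)\<^sup>2)"])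
  have "(\<Sum>j=1..D. inverse (b j ^ 4)) \<le> (\<Sum>j=1..D. w\<^sup>2)"
  proof (rule sum_mono)
    fix j assume "j \<in> {1..D}"
    then have "(inverse ((b j)\<^sup>2))\<^sup>2 \<le> w\<^sup>2" using assms by (intro power_mono) auto
    then show "inverse (b j ^ 4) \<le> w\<^sup>2" by (simp add: power_inverse)
  qed
  then have "noise_level b D \<le> sqrt (real D * w\<^sup>2)"
    unfolding noise_level_def by (intro real_sqrt_le_mono) simp
  then show ?thesis using w by (simp add: real_sqrt_mult)
qed (simp add: noise_level_def)

lemma noise_level_ge:
  assumes "A \<subseteq> {1..D}" "\<And>j. j \<in> A \<Longrightarrow> w \<le> inverse ((b j)\<^sup>2)" and w: "0 \<le> w"
  shows "sqrt (real (card A)) * w \<le> noise_level b D"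
proof -
  have "(\<Sum>j\<in>A. w\<^sup>2) \<le> (\<Sum>j\<in>A. inverse (b j ^ 4))"
  proof (rule sum_mono)
    fix j assume "j \<in> A"
    then have "w\<^sup>2 \<le> (inverse ((b j)\<^sup>2))\<^sup>2" using assms by (intro power_mono) auto
    then show "w\<^sup>2 \<le> inverse (b j ^ 4)" by (simp add: power_inverse)
  qed
  also have "\<dots> \<le> (\<Sum>j=1..D. inverse (b j ^ 4))"
    using assms(1) by (intro sum_mono2) auto
  finally have "sqrt (real (card A) * w\<^sup>2) \<le> noise_level b D"
    unfolding noise_level_def by (intro real_sqrt_le_mono) simp
  then show ?thesis using w by (simp add: real_sqrt_mult)
qed

text \<open>At least half of the indices up to \<open>D\<close> are no smaller than \<open>D / 2\<close>, and each of them contributes as much as the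
  largest one up to a constant; the square root of their number gives the extra exponent 1/2.\<close>

lemma noise_level_polynomialE:
  assumes b: "b \<simeq> (\<lambda>k. real k powr (- t))" and t: "0 < t"
  obtains c\<^sub>1 c\<^sub>2 where "0 < c\<^sub>1" "0 < c\<^sub>2"
    "\<And>D. c\<^sub>1 * real D powr (2 * t + 1/2) \<le> noise_level b D"
    "\<And>D. noise_level b D \<le> c\<^sub>2 * real D powr (2 * t + 1/2)"
proof -
  obtain c\<^sub>1 c\<^sub>2 where c: "0 < c\<^sub>1" "0 < c\<^sub>2"
    "\<And>k. 1 \<le> k \<Longrightarrow> c\<^sub>1 * real k powr (2 * t) \<le> inverse ((b k)\<^sup>2)"
    "\<And>k. 1 \<le> k \<Longrightarrow> inverse ((b k)\<^sup>2) \<le> c\<^sub>2 * real k powr (2 * t)"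
    using polynomial_weightsE[OF b] by auto
  show thesis
  proof
    show "0 < c\<^sub>1 * (1/2) powr (2 * t + 1/2)" "0 < c\<^sub>2" using c by auto
    fix D :: nat
    have split: "x powr (2 * t + 1/2) = sqrt x * x powr (2 * t)" if "0 \<le> x" for x :: real
      using that by (simp add: powr_add powr_half_sqrt)
    have "noise_level b D \<le> sqrt (real D) * (c\<^sub>2 * real D powr (2 * t))"
    proof (rule noise_level_le)
      fix j assume j: "j \<in> {1..D}"
      then have "c\<^sub>2 * real j powr (2 * t) \<le> c\<^sub>2 * real D powr (2 * t)"
        using c t by (intro mult_left_mono powr_mono2) auto
      then show "inverse ((b j)\<^sup>2) \<le> c\<^sub>2 * real D powr (2 * t)" using c(4)[of j] j by auto
    qed
    then show "noise_level b D \<le> c\<^sub>2 * real D powr (2 * t + 1/2)"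
      unfolding split[OF of_nat_0_le_iff] by (simp add: mult_ac)
    let ?A = "{(D + 1) div 2..D}"
    show "c\<^sub>1 * (1/2) powr (2 * t + 1/2) * real D powr (2 * t + 1/2) \<le> noise_level b D"
    proof (cases "D = 0")
      case False
      have "sqrt (real D / 2) * (c\<^sub>1 * (real D / 2) powr (2 * t)) \<le> sqrt (real (card ?A)) * (c\<^sub>1 * (real D / 2) powr (2 * t))"
        using c by (intro mult_right_mono real_sqrt_le_mono) auto
      also have "\<dots> \<le> noise_level b D"
      proof (rule noise_level_ge)
        show "?A \<subseteq> {1..D}" using False by auto
        fix j assume j: "j \<in> ?A"
        then have "D \<le> 2 * j" "1 \<le> j" using False by auto
        then have "c\<^sub>1 * (real D / 2) powr (2 * t) \<le> c\<^sub>1 * real j powr (2 * t)"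
          using c t by (intro mult_left_mono powr_mono2) auto
        then show "c\<^sub>1 * (real D / 2) powr (2 * t) \<le> inverse ((b j)\<^sup>2)" using c(3)[of j] \<open>1 \<le> j\<close> by auto
      qed (use c in auto)
      also have "sqrt (real D / 2) * (c\<^sub>1 * (real D / 2) powr (2 * t)) = c\<^sub>1 * (real D / 2) powr (2 * t + 1/2)"
        by (simp add: split)
      also have "(real D / 2) powr (2 * t + 1/2) = (1/2) powr (2 * t + 1/2) * real D powr (2 * t + 1/2)"
        by (subst powr_mult[symmetric]) auto
      finally show ?thesis by (simp add: mult_ac)
    qed (simp add: noise_level_def)
  qed
qed

text \<open>The last coordinate alone gives the lower bound.  The factor \<open>sqrt D\<close> in the upper bound is not sharp,
  but polynomial factors do not matter for logarithmic rates.\<close>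

lemma noise_level_exponentialE:
  assumes b: "b \<simeq> (\<lambda>k. exp (- \<gamma> * real k powr r))" and \<gamma>: "0 < \<gamma>" and r: "0 < r"
  obtains c\<^sub>1 c\<^sub>2 where "0 < c\<^sub>1" "0 < c\<^sub>2"
    "\<And>D. 1 \<le> D \<Longrightarrow> c\<^sub>1 * exp (2 * \<gamma> * real D powr r) \<le> noise_level b D"
    "\<And>D. noise_level b D \<le> c\<^sub>2 * (sqrt (real D) * exp (2 * \<gamma> * real D powr r))"
proof -
  obtain c\<^sub>1 c\<^sub>2 where c: "0 < c\<^sub>1" "0 < c\<^sub>2"
    "\<And>k. 1 \<le> k \<Longrightarrow> c\<^sub>1 * exp (2 * \<gamma> * real k powr r) \<le> inverse ((b k)\<^sup>2)"
    "\<And>k. 1 \<le> k \<Longrightarrow> inverse ((b k)\<^sup>2) \<le> c\<^sub>2 * exp (2 * \<gamma> * real k powr r)"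
    using exponential_weightsE[OF b] by (auto simp: mult.assoc)
  show thesis
  proof
    show "0 < c\<^sub>1" "0 < c\<^sub>2" by fact+
    fix D :: nat
    show "c\<^sub>1 * exp (2 * \<gamma> * real D powr r) \<le> noise_level b D" if "1 \<le> D"
      using noise_level_ge[of "{D}" D "c\<^sub>1 * exp (2 * \<gamma> * real D powr r)" b] c(1,3) that by simp
    have "noise_level b D \<le> sqrt (real D) * (c\<^sub>2 * exp (2 * \<gamma> * real D powr r))"
    proof (rule noise_level_le)
      fix j assume j: "j \<in> {1..D}"
      then have "c\<^sub>2 * exp (2 * \<gamma> * real j powr r) \<le> c\<^sub>2 * exp (2 * \<gamma> * real D powr r)"
        using c \<gamma> r by (auto intro!: mult_left_mono powr_mono2)
      then show "inverse ((b j)\<^sup>2) \<le> c\<^sub>2 * exp (2 * \<gamma> * real D powr r)" using c(4)[of j] j by auto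
    qed
    then show "noise_level b D \<le> c\<^sub>2 * (sqrt (real D) * exp (2 * \<gamma> * real D powr r))" by (simp add: mult_ac)
  qed
qed

lemma floor_bounds:
  fixes x :: real assumes "0 \<le> x"
  shows "real (nat \<lfloor>x\<rfloor>) \<le> x" "x < real (Suc (nat \<lfloor>x\<rfloor>))"
  using assms by linarith+

locale testing_problem =
  fixes \<alpha> \<beta> R :: real and a b :: "nat \<Rightarrow> real"
  assumes \<alpha>: "0 < \<alpha>" and \<beta>: "0 < \<beta>" "\<beta> < 1 - \<alpha>" and R: "0 < R"
    and b: "\<forall>j\<in>J. 0 < b j" and a: "\<forall>k\<in>J. 0 < a k" "mono_on J a"
begin

abbreviation rate2 :: "real \<Rightarrow> ereal" where
  "rate2 \<sigma> \<equiv> (minimax_rate b \<sigma> (ellipsoid a R) \<alpha> \<beta>)\<^sup>2"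

lemma noise_level_nonneg: "0 \<le> noise_level b D"
  unfolding noise_level_def by (auto intro!: sum_nonneg)

text \<open>Here and in the next lemma the constants are absorbed into \<open>c\<close>, so that what remains is a comparison of
  noise level and bias at a well chosen dimension \<open>D\<close>.\<close>

lemma rate2_lowerE:
  obtains c where "0 < c"
    "\<And>\<sigma> D p. \<lbrakk>0 < \<sigma>; 1 \<le> D; p \<le> \<sigma>\<^sup>2 * noise_level b D; p \<le> inverse ((a D)\<^sup>2)\<rbrakk> \<Longrightarrow> ereal (c * p) \<le> rate2 \<sigma>"
proof
  let ?c = "min (c_const \<alpha> \<beta>) (R\<^sup>2)"
  show "0 < ?c" using c_const_pos[OF \<beta>(2)] R by simp
  fix \<sigma> p :: real and D :: nat
  assume \<sigma>: "0 < \<sigma>" and D: "1 \<le> D" and p: "p \<le> \<sigma>\<^sup>2 * noise_level b D" "p \<le> inverse ((a D)\<^sup>2)"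
  have "?c * p \<le> ?c * (\<sigma>\<^sup>2 * noise_level b D)" "?c * p \<le> ?c * inverse ((a D)\<^sup>2)"
    using p \<open>0 < ?c\<close> by (auto intro: mult_left_mono simp del: min_less_iff_conj)
  moreover have "?c * (\<sigma>\<^sup>2 * noise_level b D) \<le> rho_sq \<alpha> \<beta> b \<sigma> D"
    unfolding rho_sq_def noise_level_def[symmetric] mult.assoc
    by (intro mult_right_mono) (auto simp: noise_level_nonneg)
  moreover have "?c * inverse ((a D)\<^sup>2) \<le> R\<^sup>2 * inverse ((a D)\<^sup>2)"
    by (intro mult_right_mono) auto
  ultimately have "ereal (?c * p) \<le> ereal (min (rho_sq \<alpha> \<beta> b \<sigma> D) (R\<^sup>2 * inverse ((a D)\<^sup>2)))"
    by simp
  also have "\<dots> \<le> rate2 \<sigma>" by (rule minimax_rate_lower[OF \<beta>(2) \<sigma> b a D])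
  finally show "ereal (?c * p) \<le> rate2 \<sigma>" .
qed

lemma rate2_upperE:
  obtains c where "0 < c"
    "\<And>\<sigma> D p q. \<lbrakk>0 < \<sigma>; \<sigma>\<^sup>2 * noise_level b D \<le> p; inverse ((a (Suc D))\<^sup>2) \<le> q\<rbrakk> \<Longrightarrow> rate2 \<sigma> \<le> ereal (c * (p + q))"
proof
  let ?c = "max (upper_const \<alpha> \<beta>) (R\<^sup>2)"
  show c: "0 < ?c" using R by (simp add: less_max_iff_disj)
  fix \<sigma> p q :: real and D :: nat
  assume \<sigma>: "0 < \<sigma>" and p: "\<sigma>\<^sup>2 * noise_level b D \<le> p" and q: "inverse ((a (Suc D))\<^sup>2) \<le> q"
  have "rate2 \<sigma> \<le> ereal (upper_const \<alpha> \<beta> * (\<sigma>\<^sup>2 * noise_level b D) + R\<^sup>2 * inverse ((a (Suc D))\<^sup>2))"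
    unfolding noise_level_def by (rule minimax_rate_upper[OF \<alpha> \<beta>(1) \<sigma> b a])
  also have "upper_const \<alpha> \<beta> * (\<sigma>\<^sup>2 * noise_level b D) + R\<^sup>2 * inverse ((a (Suc D))\<^sup>2) \<le> ?c * p + ?c * q"
    using p q c noise_level_nonneg
    by (intro add_mono mult_mono) (auto intro: order_trans[of 0 "\<sigma>\<^sup>2 * noise_level b D"])
  also have "\<dots> = ?c * (p + q)" by (simp add: distrib_left)
  finally show "rate2 \<sigma> \<le> ereal (?c * (p + q))" by simp
qed

end

section \<open>The cut-off dimension\<close>

text \<open>The interpolation of the strictly increasing sequence \<open>h\<close> has exactly one zero, namely the zero of the
  affine piece over the interval on which \<open>h\<close> changes sign.\<close>

lemma floor_interpolated_zero:
  fixes f g :: "nat \<Rightarrow> real"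
  defines "h \<equiv> \<lambda>n. f n - g n"
  assumes mono: "strict_mono h" and D: "h D \<le> 0" "0 < h (Suc D)"
  shows "nat \<lfloor>THE x. 0 \<le> x \<and> interpolate f x = interpolate g x\<rfloor> = D"
proof -
  have inc: "h m < h n" if "m < n" for m n using strict_monoD[OF mono that] .
  define \<phi> where "\<phi> = - h D / (h (Suc D) - h D)"
  have gap: "0 < h (Suc D) - h D" using D by simp
  have \<phi>: "0 \<le> \<phi>" "\<phi> < 1" "\<phi> * (h (Suc D) - h D) = - h D"
    using D gap by (auto simp: \<phi>_def divide_simps)
  have eq: "interpolate f x = interpolate g x \<longleftrightarrow>
      (1 - frac x) * h (nat \<lfloor>x\<rfloor>) + frac x * h (Suc (nat \<lfloor>x\<rfloor>)) = 0" for x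
    by (auto simp: interpolate_def h_def algebra_simps)
  have "(THE x. 0 \<le> x \<and> interpolate f x = interpolate g x) = real D + \<phi>"
  proof (rule the_equality, unfold eq)
    have "\<lfloor>real D + \<phi>\<rfloor> = int D" "frac (real D + \<phi>) = \<phi>"
      using \<phi> by (auto simp: floor_eq_iff frac_unique_iff)
    then show "0 \<le> real D + \<phi> \<and> (1 - frac (real D + \<phi>)) * h (nat \<lfloor>real D + \<phi>\<rfloor>)
        + frac (real D + \<phi>) * h (Suc (nat \<lfloor>real D + \<phi>\<rfloor>)) = 0"
      using \<phi> by (simp add: algebra_simps)
  next
    fix x :: real
    let ?n = "nat \<lfloor>x\<rfloor>"
    assume x: "0 \<le> x \<and> (1 - frac x) * h ?n + frac x * h (Suc ?n) = 0"
    have fr: "0 \<le> frac x" "frac x < 1" by (auto simp: frac_ge_0 frac_lt_1)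
    have lin: "h ?n + frac x * (h (Suc ?n) - h ?n) = 0" using x by (simp add: algebra_simps)
    have up: "0 < h (Suc ?n) - h ?n" using inc[of ?n "Suc ?n"] by simp
    have "frac x * (h (Suc ?n) - h ?n) < 1 * (h (Suc ?n) - h ?n)"
      using fr up by (intro mult_strict_right_mono)
    then have pos: "0 < h (Suc ?n)" using lin by simp
    have "0 \<le> frac x * (h (Suc ?n) - h ?n)" using fr up by simp
    then have neg: "h ?n \<le> 0" using lin by simp
    have "?n = D"
    proof (rule linorder_cases[of ?n D])
      assume "?n < D"
      then have "Suc ?n = D \<or> Suc ?n < D" by auto
      then show ?thesis using inc[of "Suc ?n" D] pos D by auto
    next
      assume "D < ?n"
      then have "Suc D = ?n \<or> Suc D < ?n" by auto
      then show ?thesis using inc[of "Suc D" ?n] neg D by auto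
    qed auto
    moreover from this have "frac x * (h (Suc D) - h D) = \<phi> * (h (Suc D) - h D)"
      using lin \<phi> by simp
    then have "frac x = \<phi>" using gap by simp
    moreover have "x = real ?n + frac x" using x by (simp add: frac_def)
    ultimately show "x = real D + \<phi>" by simp
  qed
  moreover have "\<lfloor>real D + \<phi>\<rfloor> = int D" using \<phi> by (simp add: floor_eq_iff)
  ultimately show ?thesis by simp
qed

context testing_problem
begin

text \<open>Boundedness of \<open>b\<close> makes \<open>\<rho>\<^sub>D\<^sup>2\<close> unbounded in \<open>D\<close>, so that it eventually exceeds the right-hand side.\<close>

lemma cutoff_bracket:
  assumes \<sigma>: "0 < \<sigma>" and bdd: "\<And>j. 1 \<le> j \<Longrightarrow> b j \<le> B"
  defines "D \<equiv> cutoff \<alpha> \<beta> R a b \<sigma>"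
  shows "rho_sq \<alpha> \<beta> b \<sigma> D \<le> R\<^sup>2 * inverse ((a (max 1 D))\<^sup>2)"
    and "R\<^sup>2 * inverse ((a (Suc D))\<^sup>2) < rho_sq \<alpha> \<beta> b \<sigma> (Suc D)"
proof -
  let ?g = "\<lambda>D. R\<^sup>2 * inverse ((a (max 1 D))\<^sup>2)"
  define h where "h n = rho_sq \<alpha> \<beta> b \<sigma> n - ?g n" for n
  have c: "0 < c_const \<alpha> \<beta>" by (rule c_const_pos[OF \<beta>(2)])
  have bpos: "0 < b j" if "1 \<le> j" for j using b that by auto
  have apos: "0 < a j" if "1 \<le> j" for j using a that by auto
  have rho: "rho_sq \<alpha> \<beta> b \<sigma> n < rho_sq \<alpha> \<beta> b \<sigma> (Suc n)" for n
    using c \<sigma> bpos[of "Suc n"] unfolding rho_sq_def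
    by (intro mult_strict_left_mono real_sqrt_less_mono) auto
  have g: "?g (Suc n) \<le> ?g n" for n
  proof -
    have "a (max 1 n) \<le> a (max 1 (Suc n))" by (rule mono_onD[OF a(2)]) auto
    then show ?thesis
      using apos[of "max 1 n"] by (intro mult_left_mono le_imp_inverse_le power_mono) auto
  qed
  have mono: "strict_mono h"
    unfolding strict_mono_Suc_iff h_def using rho g by (auto intro: diff_strict_right_mono less_le_trans diff_less_mono2 simp: algebra_simps add_less_le_mono)
  have unbounded: "\<exists>n. 0 < h n"
  proof -
    have B: "0 < B" using bdd[of 1] bpos[of 1] by simp
    obtain n :: nat where n: "(R\<^sup>2 * inverse ((a 1)\<^sup>2) / (c_const \<alpha> \<beta> * \<sigma>\<^sup>2))\<^sup>2 * B ^ 4 < real n"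
      using reals_Archimedean2 by blast
    have "R\<^sup>2 * inverse ((a 1)\<^sup>2) / (c_const \<alpha> \<beta> * \<sigma>\<^sup>2) < sqrt (real n * inverse (B ^ 4))"
      using n B by (intro real_less_rsqrt) (simp add: field_simps)
    also have "\<dots> \<le> sqrt (\<Sum>j=1..n. inverse (b j ^ 4))"
    proof (rule real_sqrt_le_mono)
      have "(\<Sum>j=1..n. inverse (B ^ 4)) \<le> (\<Sum>j=1..n. inverse (b j ^ 4))"
      proof (rule sum_mono)
        fix j assume "j \<in> {1..n}"
        then have "0 < b j" "b j \<le> B" using bpos bdd by auto
        then show "inverse (B ^ 4) \<le> inverse (b j ^ 4)"
          by (intro le_imp_inverse_le power_mono) auto
      qed
      then show "real n * inverse (B ^ 4) \<le> (\<Sum>j=1..n. inverse (b j ^ 4))" by simp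
    qed
    finally have "R\<^sup>2 * inverse ((a 1)\<^sup>2) < rho_sq \<alpha> \<beta> b \<sigma> n"
      using c \<sigma> by (simp add: rho_sq_def divide_less_eq mult_ac)
    moreover have "?g n \<le> R\<^sup>2 * inverse ((a 1)\<^sup>2)"
    proof -
      have "a 1 \<le> a (max 1 n)" by (rule mono_onD[OF a(2)]) auto
      then show ?thesis using apos[of 1] by (intro mult_left_mono le_imp_inverse_le power_mono) auto
    qed
    ultimately have "0 < h n" by (simp add: h_def)
    then show ?thesis ..
  qed
  define n where "n = (LEAST n. 0 < h n)"
  have n: "0 < h n" "\<And>m. m < n \<Longrightarrow> \<not> 0 < h m"
    unfolding n_def using LeastI_ex[OF unbounded] not_less_Least by auto
  have "h 0 \<le> 0" by (simp add: h_def rho_sq_def)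
  then obtain d where d: "n = Suc d" using n(1) by (cases n) auto
  have "h d \<le> 0" using n(2)[of d] d by simp
  then have "D = d"
    unfolding D_def cutoff_def using mono n(1) unfolding h_def d
    by (intro floor_interpolated_zero) auto
  then show "rho_sq \<alpha> \<beta> b \<sigma> D \<le> ?g D"
    and "R\<^sup>2 * inverse ((a (Suc D))\<^sup>2) < rho_sq \<alpha> \<beta> b \<sigma> (Suc D)"
    using \<open>h d \<le> 0\<close> n(1) by (auto simp: h_def d)
qed

end

section \<open>The four regimes\<close>

lemma noise_variance_eq_exp: "0 < \<sigma> \<Longrightarrow> \<sigma>\<^sup>2 = exp (- ln (\<sigma> powr (- 2)) :: real)"
  by (simp add: ln_powr exp_double)

lemma ln_powr_minus_two_pos: "0 < \<sigma> \<Longrightarrow> \<sigma> < 1 \<Longrightarrow> 0 < ln (\<sigma> powr (- 2) :: real)"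
  by (simp add: ln_powr)

lemma ln_powr_minus_two_antimono:
  "0 < \<sigma> \<Longrightarrow> \<sigma> \<le> \<tau> \<Longrightarrow> ln (\<tau> powr (- 2)) \<le> ln (\<sigma> powr (- 2) :: real)"
  by (simp add: ln_powr)

context testing_problem
begin

text \<open>Balancing \<open>\<sigma>\<^sup>2 D\<^bsup>2t + 1/2\<^esup>\<close> against \<open>D\<^bsup>-2s\<^esup>\<close>.\<close>

lemma polynomial_polynomial_rate:
  assumes st: "0 < s" "0 < t"
    and as: "a \<simeq> (\<lambda>k. real k powr s)" and bt: "b \<simeq> (\<lambda>k. real k powr (- t))"
  shows "\<exists>C\<^sub>1>0. \<exists>C\<^sub>2>0. \<forall>\<sigma>. 0 < \<sigma> \<and> \<sigma> < 1 \<longrightarrow>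
          ereal (C\<^sub>1 * \<sigma> powr (4 * s / (2 * s + 2 * t + 1/2))) \<le> rate2 \<sigma> \<and>
          rate2 \<sigma> \<le> ereal (C\<^sub>2 * \<sigma> powr (4 * s / (2 * s + 2 * t + 1/2)))"
proof -
  obtain A\<^sub>1 A\<^sub>2 where A: "0 < A\<^sub>1" "0 < A\<^sub>2"
    "\<And>k. 1 \<le> k \<Longrightarrow> A\<^sub>1 * real k powr (- 2 * s) \<le> inverse ((a k)\<^sup>2)"
    "\<And>k. 1 \<le> k \<Longrightarrow> inverse ((a k)\<^sup>2) \<le> A\<^sub>2 * real k powr (- 2 * s)"
    using polynomial_weightsE[OF as] by metis
  define q where "q = 2 * t + 1/2"
  define p where "p = 2 * s + 2 * t + 1/2"
  have q: "0 < q" "q - p = - 2 * s" "p = 2 * s + q" "0 < p" using st by (auto simp: q_def p_def)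
  obtain B\<^sub>1 B\<^sub>2 where B: "0 < B\<^sub>1" "0 < B\<^sub>2"
    "\<And>D. B\<^sub>1 * real D powr q \<le> noise_level b D" "\<And>D. noise_level b D \<le> B\<^sub>2 * real D powr q"
    unfolding q_def using noise_level_polynomialE[OF bt st(2)] by metis
  obtain c\<^sub>1 where c1: "0 < c\<^sub>1"
    "\<And>\<sigma> D p. \<lbrakk>0 < \<sigma>; 1 \<le> D; p \<le> \<sigma>\<^sup>2 * noise_level b D; p \<le> inverse ((a D)\<^sup>2)\<rbrakk> \<Longrightarrow> ereal (c\<^sub>1 * p) \<le> rate2 \<sigma>"
    using rate2_lowerE by blast
  obtain c\<^sub>2 where c2: "0 < c\<^sub>2"
    "\<And>\<sigma> D p q. \<lbrakk>0 < \<sigma>; \<sigma>\<^sup>2 * noise_level b D \<le> p; inverse ((a (Suc D))\<^sup>2) \<le> q\<rbrakk> \<Longrightarrow> rate2 \<sigma> \<le> ereal (c\<^sub>2 * (p + q))"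
    using rate2_upperE by blast
  define m where "m = min (B\<^sub>1 * (1/2) powr q) A\<^sub>1"
  have m: "0 < m" using A B by (simp add: m_def)
  show ?thesis unfolding p_def[symmetric]
  proof (intro exI conjI allI impI)
    show "0 < c\<^sub>1 * m" "0 < c\<^sub>2 * (B\<^sub>2 + A\<^sub>2)" using c1 c2 m A B by auto
    fix \<sigma> :: real assume "0 < \<sigma> \<and> \<sigma> < 1"
    then have \<sigma>: "0 < \<sigma>" "\<sigma> < 1" by auto
    \<comment> \<open>The real dimension at which noise level \<open>\<sigma>\<^sup>2 x\<^sup>q\<close> and squared bias \<open>x\<^sup>-\<^sup>2\<^sup>s\<close> agree.\<close>
    define x where "x = \<sigma> powr (- 2 / p)"
    define D where "D = nat \<lfloor>x\<rfloor>"
    define f where "f = \<sigma> powr (4 * s / p)"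
    have "\<sigma> powr 0 \<le> \<sigma> powr (- 2 / p)" using \<sigma> q by (intro powr_mono') auto
    then have x1: "1 \<le> x" using \<sigma> by (simp add: x_def)
    have D: "real D \<le> x" "x < real (Suc D)" using floor_bounds[of x] x1 by (auto simp: D_def)
    have "1 \<le> D" using D x1 by linarith
    moreover from this have "x / 2 \<le> real D" using D by simp
    ultimately have D1: "1 \<le> D" "x / 2 \<le> real D" .
    have xs: "x powr (- 2 * s) = f" by (simp add: x_def f_def powr_powr)
    have xq: "\<sigma>\<^sup>2 * x powr q = f"
    proof -
      have "\<sigma>\<^sup>2 * x powr q = \<sigma> powr (2 + (- 2 / p) * q)"
      proof -
        have "\<sigma>\<^sup>2 = \<sigma> powr 2" using \<sigma> by simp
        then show ?thesis by (simp only: x_def powr_powr powr_add)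
      qed
      also have "2 + (- 2 / p) * q = 4 * s / p" using q by (simp add: field_simps)
      finally show ?thesis by (simp add: f_def)
    qed
    have f: "0 < f" using \<sigma> by (simp add: f_def)
    show "ereal (c\<^sub>1 * m * \<sigma> powr (4 * s / p)) \<le> rate2 \<sigma>"
      unfolding f_def[symmetric] mult.assoc
    proof (rule c1(2)[OF \<sigma>(1) D1(1)])
      have "m * f \<le> B\<^sub>1 * (1/2) powr q * f" using f by (intro mult_right_mono) (auto simp: m_def)
      also have "\<dots> = \<sigma>\<^sup>2 * (B\<^sub>1 * (x / 2) powr q)"
        unfolding xq[symmetric] using x1 by (simp add: powr_divide)
      also have "\<dots> \<le> \<sigma>\<^sup>2 * (B\<^sub>1 * real D powr q)"
        using D1 x1 B q by (intro mult_left_mono powr_mono2) auto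
      also have "\<dots> \<le> \<sigma>\<^sup>2 * noise_level b D" using B by (intro mult_left_mono) auto
      finally show "m * f \<le> \<sigma>\<^sup>2 * noise_level b D" .
      have "m * f \<le> A\<^sub>1 * x powr (- 2 * s)" unfolding xs using f by (intro mult_right_mono) (auto simp: m_def)
      also have "\<dots> \<le> A\<^sub>1 * real D powr (- 2 * s)"
        using D D1 A st by (intro mult_left_mono powr_mono2') auto
      also have "\<dots> \<le> inverse ((a D)\<^sup>2)" by (rule A(3)[OF D1(1)])
      finally show "m * f \<le> inverse ((a D)\<^sup>2)" .
    qed
    have "rate2 \<sigma> \<le> ereal (c\<^sub>2 * (B\<^sub>2 * f + A\<^sub>2 * f))"
    proof (rule c2(2)[OF \<sigma>(1)])
      have "\<sigma>\<^sup>2 * noise_level b D \<le> \<sigma>\<^sup>2 * (B\<^sub>2 * real D powr q)" using B by (intro mult_left_mono) auto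
      also have "\<dots> \<le> \<sigma>\<^sup>2 * (B\<^sub>2 * x powr q)" using D B q by (intro mult_left_mono powr_mono2) auto
      also have "\<dots> = B\<^sub>2 * f" by (simp add: xq[symmetric])
      finally show "\<sigma>\<^sup>2 * noise_level b D \<le> B\<^sub>2 * f" .
      have "inverse ((a (Suc D))\<^sup>2) \<le> A\<^sub>2 * real (Suc D) powr (- 2 * s)" by (rule A(4)) simp
      also have "\<dots> \<le> A\<^sub>2 * x powr (- 2 * s)"
        using D x1 A st by (intro mult_left_mono powr_mono2') auto
      finally show "inverse ((a (Suc D))\<^sup>2) \<le> A\<^sub>2 * f" by (simp only: xs)
    qed
    then show "rate2 \<sigma> \<le> ereal (c\<^sub>2 * (B\<^sub>2 + A\<^sub>2) * \<sigma> powr (4 * s / p))"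
      by (simp add: f_def algebra_simps)
  qed
qed

text \<open>At \<open>D \<ge> (L / 2\<gamma>)\<^bsup>1/r\<^esup>\<close> with \<open>L = ln \<sigma>\<^sup>-\<^sup>2\<close> the noise level already exceeds a constant, so the bias
  \<open>D\<^bsup>-2s\<^esup>\<close> decides.  Keeping \<open>\<sigma>\<close> away from 1 bounds \<open>L\<close> from below, which is needed to absorb the rounding
  up of \<open>D\<close>; as \<open>\<sigma>\<close> tends to 1 the claimed lower bound tends to infinity.\<close>

lemma polynomial_exponential_lower:
  assumes pos: "0 < s" "0 < r" "0 < \<gamma>"
    and as: "a \<simeq> (\<lambda>k. real k powr s)" and be: "b \<simeq> (\<lambda>k. exp (- \<gamma> * real k powr r))"
    and \<sigma>\<^sub>0: "0 < \<sigma>\<^sub>0" "\<sigma>\<^sub>0 < 1"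
  shows "\<exists>C\<^sub>1>0. \<forall>\<sigma>. 0 < \<sigma> \<and> \<sigma> \<le> \<sigma>\<^sub>0 \<longrightarrow>
          ereal (C\<^sub>1 * (ln (\<sigma> powr (- 2))) powr (- 2 * s / r)) \<le> rate2 \<sigma>"
proof -
  obtain A\<^sub>1 where A: "0 < A\<^sub>1"
    "\<And>k. 1 \<le> k \<Longrightarrow> A\<^sub>1 * real k powr (- 2 * s) \<le> inverse ((a k)\<^sup>2)"
    using polynomial_weightsE[OF as] by metis
  obtain B\<^sub>1 where B: "0 < B\<^sub>1"
    "\<And>D. 1 \<le> D \<Longrightarrow> B\<^sub>1 * exp (2 * \<gamma> * real D powr r) \<le> noise_level b D"
    using noise_level_exponentialE[OF be pos(3,2)] by metis
  obtain c\<^sub>1 where c1: "0 < c\<^sub>1"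
    "\<And>\<sigma> D p. \<lbrakk>0 < \<sigma>; 1 \<le> D; p \<le> \<sigma>\<^sup>2 * noise_level b D; p \<le> inverse ((a D)\<^sup>2)\<rbrakk> \<Longrightarrow> ereal (c\<^sub>1 * p) \<le> rate2 \<sigma>"
    using rate2_lowerE by blast
  define y where "y L = (L / (2 * \<gamma>)) powr (1 / r)" for L
  define L\<^sub>0 where "L\<^sub>0 = ln (\<sigma>\<^sub>0 powr (- 2))"
  have L0: "0 < L\<^sub>0" unfolding L\<^sub>0_def by (rule ln_powr_minus_two_pos[OF \<sigma>\<^sub>0])
  define y0 where "y0 = y L\<^sub>0"
  have y0: "0 < y0" using L0 pos by (simp add: y0_def y_def)
  define k where "k = (1 + 1 / y0) powr (- 2 * s) * (1 / (2 * \<gamma>)) powr (- 2 * s / r)"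
  define m where "m = min B\<^sub>1 A\<^sub>1"
  have k: "0 < k" using pos y0 by (simp add: k_def add_pos_pos less_imp_neq[symmetric])
  have m: "0 < m" using A B by (simp add: m_def)
  show ?thesis
  proof (intro exI conjI allI impI)
    show "0 < c\<^sub>1 * (m * k)" using c1 m k by simp
    fix \<sigma> :: real assume "0 < \<sigma> \<and> \<sigma> \<le> \<sigma>\<^sub>0"
    then have \<sigma>: "0 < \<sigma>" "\<sigma> \<le> \<sigma>\<^sub>0" "\<sigma> < 1" using \<sigma>\<^sub>0 by auto
    define L where "L = ln (\<sigma> powr (- 2))"
    have L: "0 < L" "L\<^sub>0 \<le> L" "\<sigma>\<^sup>2 = exp (- L)"
      unfolding L_def L\<^sub>0_def using \<sigma> ln_powr_minus_two_pos ln_powr_minus_two_antimono noise_variance_eq_exp by auto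
    have y: "y0 \<le> y L" "y L powr r = L / (2 * \<gamma>)"
      using L pos L0
      by (auto simp: y0_def y_def powr_powr intro!: powr_mono2 divide_right_mono)
    define D where "D = nat \<lceil>y L\<rceil>"
    have D: "1 \<le> D" "y L \<le> real D" "real D \<le> y L + 1"
      unfolding D_def using y y0 by linarith+
    have Dy: "real D \<le> (1 + 1 / y0) * y L"
    proof -
      have "1 \<le> y L / y0" using y y0 by simp
      then show ?thesis using D by (simp add: algebra_simps)
    qed
    have "k * L powr (- 2 * s / r) = (1 + 1 / y0) powr (- 2 * s) * y L powr (- 2 * s)"
      using L pos unfolding k_def y_def
      by (simp add: powr_powr powr_mult[symmetric])
    also have "\<dots> = ((1 + 1 / y0) * y L) powr (- 2 * s)"
      using y0 y by (subst powr_mult) auto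
    also have "\<dots> \<le> real D powr (- 2 * s)"
      using Dy D pos by (intro powr_mono2') auto
    finally have Df: "k * L powr (- 2 * s / r) \<le> real D powr (- 2 * s)" .
    have D1: "real D powr (- 2 * s) \<le> 1"
      using powr_mono[of "- 2 * s" 0 "real D"] D pos by simp
    have "ereal (c\<^sub>1 * (m * real D powr (- 2 * s))) \<le> rate2 \<sigma>"
    proof (rule c1(2)[OF \<sigma>(1) D(1)])
      have "m * real D powr (- 2 * s) \<le> B\<^sub>1 * 1"
        using D1 B by (intro mult_mono) (auto simp: m_def)
      also have "\<dots> = \<sigma>\<^sup>2 * (B\<^sub>1 * exp (2 * \<gamma> * y L powr r))"
        using pos by (simp add: y L(3) exp_minus)
      also have "\<dots> \<le> \<sigma>\<^sup>2 * (B\<^sub>1 * exp (2 * \<gamma> * real D powr r))"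
      proof -
        have "y L powr r \<le> real D powr r" using D y y0 pos by (intro powr_mono2) auto
        then show ?thesis using pos B by (auto intro!: mult_left_mono)
      qed
      also have "\<dots> \<le> \<sigma>\<^sup>2 * noise_level b D" using B(2)[OF D(1)] by (intro mult_left_mono) auto
      finally show "m * real D powr (- 2 * s) \<le> \<sigma>\<^sup>2 * noise_level b D" .
      have "m * real D powr (- 2 * s) \<le> A\<^sub>1 * real D powr (- 2 * s)"
        by (intro mult_right_mono) (auto simp: m_def)
      also have "\<dots> \<le> inverse ((a D)\<^sup>2)" by (rule A(2)[OF D(1)])
      finally show "m * real D powr (- 2 * s) \<le> inverse ((a D)\<^sup>2)" .
    qed
    moreover have "c\<^sub>1 * (m * k) * L powr (- 2 * s / r) \<le> c\<^sub>1 * (m * real D powr (- 2 * s))"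
      unfolding mult.assoc using Df c1 m by (intro mult_left_mono) auto
    ultimately show "ereal (c\<^sub>1 * (m * k) * ln (\<sigma> powr - 2) powr (- 2 * s / r)) \<le> rate2 \<sigma>"
      unfolding L_def[symmetric] by (meson ereal_less_eq(3) order_trans)
  qed
qed

text \<open>The constant \<open>4\<gamma>\<close> in place of \<open>2\<gamma>\<close> changes \<open>D\<close> only by a constant factor, and hence the bias too, but
  reduces the noise level to about \<open>exp (- L / 2)\<close>, which is negligible against every power of \<open>L\<close>.\<close>

lemma polynomial_exponential_upper:
  assumes pos: "0 < s" "0 < r" "0 < \<gamma>"
    and as: "a \<simeq> (\<lambda>k. real k powr s)" and be: "b \<simeq> (\<lambda>k. exp (- \<gamma> * real k powr r))"
  shows "\<exists>C\<^sub>2>0. \<forall>\<sigma>. 0 < \<sigma> \<and> \<sigma> < 1 \<longrightarrow>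
          rate2 \<sigma> \<le> ereal (C\<^sub>2 * (ln (\<sigma> powr (- 2))) powr (- 2 * s / r))"
proof -
  obtain A\<^sub>2 where A: "0 < A\<^sub>2"
    "\<And>k. 1 \<le> k \<Longrightarrow> inverse ((a k)\<^sup>2) \<le> A\<^sub>2 * real k powr (- 2 * s)"
    using polynomial_weightsE[OF as] by metis
  obtain B\<^sub>2 where B: "0 < B\<^sub>2"
    "\<And>D. noise_level b D \<le> B\<^sub>2 * (sqrt (real D) * exp (2 * \<gamma> * real D powr r))"
    using noise_level_exponentialE[OF be pos(3,2)] by metis
  obtain c\<^sub>2 where c2: "0 < c\<^sub>2"
    "\<And>\<sigma> D p q. \<lbrakk>0 < \<sigma>; \<sigma>\<^sup>2 * noise_level b D \<le> p; inverse ((a (Suc D))\<^sup>2) \<le> q\<rbrakk> \<Longrightarrow> rate2 \<sigma> \<le> ereal (c\<^sub>2 * (p + q))"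
    using rate2_upperE by blast
  obtain M where M: "0 < M" "\<And>x. 0 < x \<Longrightarrow> x powr ((2 * s + 1/2) / r) * exp (- (2 * \<gamma>) * x) \<le> M"
    using powr_mult_exp_bounded[of "(2 * s + 1/2) / r" "2 * \<gamma>"] pos by auto
  define k where "k = (1 / (4 * \<gamma>)) powr (- 2 * s / r)"
  have k: "0 < k" using pos by (simp add: k_def)
  show ?thesis
  proof (intro exI conjI allI impI)
    show "0 < c\<^sub>2 * ((B\<^sub>2 * M + A\<^sub>2) * k)" using c2 M A B k by (simp add: add_pos_pos)
    fix \<sigma> :: real assume "0 < \<sigma> \<and> \<sigma> < 1"
    then have \<sigma>: "0 < \<sigma>" "\<sigma> < 1" by auto
    define L where "L = ln (\<sigma> powr (- 2))"
    have L: "0 < L" "\<sigma>\<^sup>2 = exp (- L)"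
      unfolding L_def using \<sigma> ln_powr_minus_two_pos noise_variance_eq_exp by auto
    define z where "z = L / (4 * \<gamma>)"
    define y where "y = z powr (1 / r)"
    have z: "0 < z" "L = 4 * \<gamma> * z" using L pos by (auto simp: z_def)
    have y: "0 < y" "y powr r = z" using z pos by (auto simp: y_def powr_powr)
    have ys: "y powr (- 2 * s) = k * L powr (- 2 * s / r)"
      using L pos by (simp add: y_def z_def k_def powr_powr powr_mult[symmetric])
    have "sqrt y = y powr (2 * s + 1/2) * y powr (- 2 * s)"
      using y by (simp add: powr_add[symmetric] powr_half_sqrt)
    also have "y powr (2 * s + 1/2) = z powr ((2 * s + 1/2) / r)"
      using z by (simp add: y_def powr_powr)
    finally have "sqrt y * exp (- (2 * \<gamma>) * z) = (z powr ((2 * s + 1/2) / r) * exp (- (2 * \<gamma>) * z)) * y powr (- 2 * s)"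
      by simp
    also have "\<dots> \<le> M * y powr (- 2 * s)" using M(2)[OF z(1)] by (intro mult_right_mono) auto
    finally have yM: "sqrt y * exp (- (2 * \<gamma>) * z) \<le> M * y powr (- 2 * s)" .
    define D where "D = nat \<lfloor>y\<rfloor>"
    have D: "real D \<le> y" "y < real (Suc D)" using floor_bounds[of y] y by (auto simp: D_def)
    have "rate2 \<sigma> \<le> ereal (c\<^sub>2 * (B\<^sub>2 * (M * y powr (- 2 * s)) + A\<^sub>2 * y powr (- 2 * s)))"
    proof (rule c2(2)[OF \<sigma>(1)])
      have "\<sigma>\<^sup>2 * noise_level b D \<le> \<sigma>\<^sup>2 * (B\<^sub>2 * (sqrt (real D) * exp (2 * \<gamma> * real D powr r)))"
        using B by (intro mult_left_mono) auto
      also have "\<dots> \<le> \<sigma>\<^sup>2 * (B\<^sub>2 * (sqrt y * exp (2 * \<gamma> * y powr r)))"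
        using D B pos y by (intro mult_left_mono mult_mono) (auto intro!: powr_mono2 mult_left_mono)
      also have "\<dots> = B\<^sub>2 * (sqrt y * exp (- (2 * \<gamma>) * z))"
        by (simp add: L(2) y(2) z(2) mult_exp_exp algebra_simps)
      also have "\<dots> \<le> B\<^sub>2 * (M * y powr (- 2 * s))" using yM B by (intro mult_left_mono) auto
      finally show "\<sigma>\<^sup>2 * noise_level b D \<le> B\<^sub>2 * (M * y powr (- 2 * s))" .
      have "inverse ((a (Suc D))\<^sup>2) \<le> A\<^sub>2 * real (Suc D) powr (- 2 * s)" by (rule A(2)) simp
      also have "\<dots> \<le> A\<^sub>2 * y powr (- 2 * s)"
        using D y A pos by (intro mult_left_mono powr_mono2') auto
      finally show "inverse ((a (Suc D))\<^sup>2) \<le> A\<^sub>2 * y powr (- 2 * s)" .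
    qed
    then show "rate2 \<sigma> \<le> ereal (c\<^sub>2 * ((B\<^sub>2 * M + A\<^sub>2) * k) * ln (\<sigma> powr - 2) powr (- 2 * s / r))"
      unfolding ys L_def[symmetric] by (simp add: algebra_simps)
  qed
qed

text \<open>Here the noise level decides: at \<open>D \<approx> (L / 4\<nu>)\<^bsup>1/s\<^esup>\<close> the bias is still of order \<open>exp (- L / 2)\<close>, far above
  \<open>\<sigma>\<^sup>2 = exp (- L)\<close>.\<close>

lemma exponential_polynomial_lower:
  assumes pos: "0 < s" "0 < t" "0 < \<nu>"
    and ae: "a \<simeq> (\<lambda>k. exp (\<nu> * real k powr s))" and bt: "b \<simeq> (\<lambda>k. real k powr (- t))"
  shows "\<exists>C\<^sub>1>0. \<forall>\<sigma>. 0 < \<sigma> \<and> \<sigma> < 1 \<longrightarrow>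
          ereal (C\<^sub>1 * (\<sigma>\<^sup>2 * (ln (\<sigma> powr (- 2))) powr ((2 * t + 1/2) / s))) \<le> rate2 \<sigma>"
proof -
  define q where "q = 2 * t + 1/2"
  have q: "0 < q" using pos by (simp add: q_def)
  obtain A\<^sub>1 where A: "0 < A\<^sub>1"
    "\<And>k. 1 \<le> k \<Longrightarrow> A\<^sub>1 * exp (- 2 * (\<nu> * real k powr s)) \<le> inverse ((a k)\<^sup>2)"
    using exponential_weightsE[OF ae] by metis
  obtain B\<^sub>1 where B: "0 < B\<^sub>1" "\<And>D. B\<^sub>1 * real D powr q \<le> noise_level b D"
    unfolding q_def using noise_level_polynomialE[OF bt pos(2)] by metis
  obtain c\<^sub>1 where c1: "0 < c\<^sub>1"
    "\<And>\<sigma> D p. \<lbrakk>0 < \<sigma>; 1 \<le> D; p \<le> \<sigma>\<^sup>2 * noise_level b D; p \<le> inverse ((a D)\<^sup>2)\<rbrakk> \<Longrightarrow> ereal (c\<^sub>1 * p) \<le> rate2 \<sigma>"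
    using rate2_lowerE by blast
  obtain M where M: "0 < M" "\<And>x. 0 < x \<Longrightarrow> x powr (q / s) * exp (- (1/2) * x) \<le> M"
    using powr_mult_exp_bounded[of "q / s" "1/2"] pos q by auto
  define k where "k = (1/2) powr q * (1 / (4 * \<nu>)) powr (q / s)"
  define m where "m = min (B\<^sub>1 * k) (A\<^sub>1 * exp (- 2 * \<nu>) / M)"
  have m: "0 < m" using A B M pos by (simp add: m_def k_def)
  show ?thesis unfolding q_def[symmetric]
  proof (intro exI conjI allI impI)
    show "0 < c\<^sub>1 * m" using c1 m by simp
    fix \<sigma> :: real assume "0 < \<sigma> \<and> \<sigma> < 1"
    then have \<sigma>: "0 < \<sigma>" "\<sigma> < 1" by auto
    define L where "L = ln (\<sigma> powr (- 2))"
    have L: "0 < L" "\<sigma>\<^sup>2 = exp (- L)"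
      unfolding L_def using \<sigma> ln_powr_minus_two_pos noise_variance_eq_exp by auto
    define y where "y = (L / (4 * \<nu>)) powr (1 / s)"
    have y: "0 < y" "y powr s = L / (4 * \<nu>)" using L pos by (auto simp: y_def powr_powr)
    define D where "D = max 1 (nat \<lfloor>y\<rfloor>)"
    have D1: "1 \<le> D" by (simp add: D_def)
    have Dy: "real D \<le> max 1 y"
    proof -
      define n where "n = nat \<lfloor>y\<rfloor>"
      have "real n \<le> y" using floor_bounds(1)[of y] y by (simp add: n_def)
      then show ?thesis by (auto simp: D_def n_def[symmetric] max_def)
    qed
    have D2: "y / 2 \<le> real D" using floor_bounds(2)[of y] y D1 unfolding D_def by linarith
    show "ereal (c\<^sub>1 * m * (\<sigma>\<^sup>2 * ln (\<sigma> powr - 2) powr (q / s))) \<le> rate2 \<sigma>"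
      unfolding L_def[symmetric] mult.assoc
    proof (rule c1(2)[OF \<sigma>(1) D1])
      have "m * (\<sigma>\<^sup>2 * L powr (q / s)) \<le> B\<^sub>1 * k * (\<sigma>\<^sup>2 * L powr (q / s))"
        by (intro mult_right_mono) (auto simp: m_def)
      also have "\<dots> = \<sigma>\<^sup>2 * (B\<^sub>1 * (y / 2) powr q)"
      proof -
        have "y powr q = (1 / (4 * \<nu>)) powr (q / s) * L powr (q / s)"
          using L pos by (simp add: y_def powr_divide powr_powr)
        moreover have "(y / 2) powr q = (1/2) powr q * y powr q"
          using y by (simp add: powr_divide)
        ultimately show ?thesis by (simp add: k_def)
      qed
      also have "\<dots> \<le> \<sigma>\<^sup>2 * (B\<^sub>1 * real D powr q)"
        using D2 y B q by (intro mult_left_mono powr_mono2) auto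
      also have "\<dots> \<le> \<sigma>\<^sup>2 * noise_level b D" using B by (intro mult_left_mono) auto
      finally show "m * (\<sigma>\<^sup>2 * L powr (q / s)) \<le> \<sigma>\<^sup>2 * noise_level b D" .
      have "real D powr s \<le> (max 1 y) powr s" using Dy pos by (intro powr_mono2) auto
      also have "\<dots> \<le> 1 + L / (4 * \<nu>)" using y L pos by (auto simp: max_def)
      finally have "2 * (\<nu> * real D powr s) \<le> 2 * (\<nu> * (1 + L / (4 * \<nu>)))"
        using pos by (intro mult_left_mono) auto
      also have "\<dots> = 2 * \<nu> + L / 2" using pos by (simp add: field_simps)
      finally have De: "exp (- 2 * \<nu> - L / 2) \<le> exp (- 2 * (\<nu> * real D powr s))" by simp
      have "m * (\<sigma>\<^sup>2 * L powr (q / s)) \<le> A\<^sub>1 * exp (- 2 * \<nu>) / M * (exp (- L) * L powr (q / s))"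
        unfolding L(2) by (intro mult_right_mono) (auto simp: m_def)
      also have "\<dots> = A\<^sub>1 * exp (- 2 * \<nu> - L / 2) / M * (L powr (q / s) * exp (- (1/2) * L))"
      proof -
        have "exp (- 2 * \<nu>) * exp (- L) = exp (- 2 * \<nu> - L / 2) * exp (- (1/2) * L)"
          by (simp add: mult_exp_exp)
        then show ?thesis by simp
      qed
      also have "\<dots> \<le> A\<^sub>1 * exp (- 2 * \<nu> - L / 2) / M * M"
        using M(2)[OF L(1)] A M by (intro mult_left_mono) auto
      also have "\<dots> = A\<^sub>1 * exp (- 2 * \<nu> - L / 2)" using M by simp
      also have "\<dots> \<le> A\<^sub>1 * exp (- 2 * (\<nu> * real D powr s))" using De A by (intro mult_left_mono) auto
      also have "\<dots> \<le> inverse ((a D)\<^sup>2)" by (rule A(2)[OF D1])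
      finally show "m * (\<sigma>\<^sup>2 * L powr (q / s)) \<le> inverse ((a D)\<^sup>2)" .
    qed
  qed
qed

text \<open>At \<open>D + 1 \<ge> (L / 2\<nu>)\<^bsup>1/s\<^esup>\<close> the bias has dropped to \<open>exp (- L) = \<sigma>\<^sup>2\<close>.  It is dominated by the noise level
  because \<open>L\<close> is bounded away from 0; as \<open>\<sigma>\<close> tends to 1 the claimed upper bound tends to 0.\<close>

lemma exponential_polynomial_upper:
  assumes pos: "0 < s" "0 < t" "0 < \<nu>"
    and ae: "a \<simeq> (\<lambda>k. exp (\<nu> * real k powr s))" and bt: "b \<simeq> (\<lambda>k. real k powr (- t))"
    and \<sigma>\<^sub>0: "0 < \<sigma>\<^sub>0" "\<sigma>\<^sub>0 < 1"
  shows "\<exists>C\<^sub>2>0. \<forall>\<sigma>. 0 < \<sigma> \<and> \<sigma> \<le> \<sigma>\<^sub>0 \<longrightarrow>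
          rate2 \<sigma> \<le> ereal (C\<^sub>2 * (\<sigma>\<^sup>2 * (ln (\<sigma> powr (- 2))) powr ((2 * t + 1/2) / s)))"
proof -
  define q where "q = 2 * t + 1/2"
  have q: "0 < q" using pos by (simp add: q_def)
  obtain A\<^sub>2 where A: "0 < A\<^sub>2"
    "\<And>k. 1 \<le> k \<Longrightarrow> inverse ((a k)\<^sup>2) \<le> A\<^sub>2 * exp (- 2 * (\<nu> * real k powr s))"
    using exponential_weightsE[OF ae] by metis
  obtain B\<^sub>2 where B: "0 < B\<^sub>2" "\<And>D. noise_level b D \<le> B\<^sub>2 * real D powr q"
    unfolding q_def using noise_level_polynomialE[OF bt pos(2)] by metis
  obtain c\<^sub>2 where c2: "0 < c\<^sub>2"
    "\<And>\<sigma> D p q. \<lbrakk>0 < \<sigma>; \<sigma>\<^sup>2 * noise_level b D \<le> p; inverse ((a (Suc D))\<^sup>2) \<le> q\<rbrakk> \<Longrightarrow> rate2 \<sigma> \<le> ereal (c\<^sub>2 * (p + q))"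
    using rate2_upperE by blast
  define L0 where "L0 = ln (\<sigma>\<^sub>0 powr (- 2))"
  have L0: "0 < L0" unfolding L0_def by (rule ln_powr_minus_two_pos[OF \<sigma>\<^sub>0])
  define k where "k = (1 / (2 * \<nu>)) powr (q / s)"
  show ?thesis unfolding q_def[symmetric]
  proof (intro exI conjI allI impI)
    show "0 < c\<^sub>2 * (B\<^sub>2 * k + A\<^sub>2 * L0 powr (- (q / s)))"
      using c2 A B L0 pos by (simp add: k_def add_pos_pos)
    fix \<sigma> :: real assume "0 < \<sigma> \<and> \<sigma> \<le> \<sigma>\<^sub>0"
    then have \<sigma>: "0 < \<sigma>" "\<sigma> \<le> \<sigma>\<^sub>0" "\<sigma> < 1" using \<sigma>\<^sub>0 by auto
    define L where "L = ln (\<sigma> powr (- 2))"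
    have L: "0 < L" "L0 \<le> L" "\<sigma>\<^sup>2 = exp (- L)"
      unfolding L_def L0_def using \<sigma> ln_powr_minus_two_pos ln_powr_minus_two_antimono noise_variance_eq_exp by auto
    define y where "y = (L / (2 * \<nu>)) powr (1 / s)"
    have y: "0 < y" "y powr s = L / (2 * \<nu>)" using L pos by (auto simp: y_def powr_powr)
    define D where "D = nat \<lfloor>y\<rfloor>"
    have D: "real D \<le> y" "y < real (Suc D)" using floor_bounds[of y] y by (auto simp: D_def)
    have "rate2 \<sigma> \<le> ereal (c\<^sub>2 * (B\<^sub>2 * k * (\<sigma>\<^sup>2 * L powr (q / s)) + A\<^sub>2 * L0 powr (- (q / s)) * (\<sigma>\<^sup>2 * L powr (q / s))))"
    proof (rule c2(2)[OF \<sigma>(1)])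
      have "\<sigma>\<^sup>2 * noise_level b D \<le> \<sigma>\<^sup>2 * (B\<^sub>2 * real D powr q)" using B by (intro mult_left_mono) auto
      also have "\<dots> \<le> \<sigma>\<^sup>2 * (B\<^sub>2 * y powr q)" using D B q by (intro mult_left_mono powr_mono2) auto
      also have "\<dots> = B\<^sub>2 * k * (\<sigma>\<^sup>2 * L powr (q / s))"
        using L pos by (simp add: k_def y_def powr_divide powr_powr)
      finally show "\<sigma>\<^sup>2 * noise_level b D \<le> B\<^sub>2 * k * (\<sigma>\<^sup>2 * L powr (q / s))" .
      have "L / (2 * \<nu>) \<le> real (Suc D) powr s"
        unfolding y(2)[symmetric] using D y pos by (intro powr_mono2) auto
      then have "L \<le> 2 * (\<nu> * real (Suc D) powr s)" using pos by (simp add: field_simps)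
      then have De: "exp (- 2 * (\<nu> * real (Suc D) powr s)) \<le> exp (- L)" by simp
      have "1 = L0 powr (- (q / s)) * L0 powr (q / s)" using L0 by (simp add: powr_minus)
      also have "\<dots> \<le> L0 powr (- (q / s)) * L powr (q / s)"
        using L L0 q pos by (intro mult_left_mono powr_mono2) auto
      finally have one: "1 \<le> L0 powr (- (q / s)) * L powr (q / s)" .
      have "inverse ((a (Suc D))\<^sup>2) \<le> A\<^sub>2 * exp (- 2 * (\<nu> * real (Suc D) powr s))" by (rule A(2)) simp
      also have "\<dots> \<le> A\<^sub>2 * exp (- L) * 1" using De A by simp
      also have "\<dots> \<le> A\<^sub>2 * exp (- L) * (L0 powr (- (q / s)) * L powr (q / s))"
        using one A by (intro mult_left_mono) auto
      also have "\<dots> = A\<^sub>2 * L0 powr (- (q / s)) * (\<sigma>\<^sup>2 * L powr (q / s))" by (simp add: L(3))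
      finally show "inverse ((a (Suc D))\<^sup>2) \<le> A\<^sub>2 * L0 powr (- (q / s)) * (\<sigma>\<^sup>2 * L powr (q / s))" .
    qed
    then show "rate2 \<sigma> \<le> ereal (c\<^sub>2 * (B\<^sub>2 * k + A\<^sub>2 * L0 powr (- (q / s))) * (\<sigma>\<^sup>2 * ln (\<sigma> powr - 2) powr (q / s)))"
      unfolding L_def[symmetric] by (simp add: algebra_simps)
  qed
qed

text \<open>The cut-off \<open>D\<close> satisfies \<open>\<rho>\<^sub>D\<^sup>2 \<le> R\<^sup>2 a\<^sub>D\<^sup>-\<^sup>2\<close> and \<open>R\<^sup>2 a\<^sub>D\<^sub>+\<^sub>1\<^sup>-\<^sup>2 < \<rho>\<^sub>D\<^sub>+\<^sub>1\<^sup>2\<close>, with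
  \<open>a\<^sub>1\<close> in place of \<open>a\<^sub>0\<close> if \<open>D = 0\<close>.  The lower bound is used at \<open>D + 1\<close>, the
  upper bound at \<open>D\<close>, and the two resulting biases are comparable because \<open>s \<le> 1\<close> gives
  \<open>(D + 1)\<^sup>s \<le> D\<^sup>s + 1\<close>.\<close>

lemma exponential_exponential_rate:
  assumes pos: "0 < s" "s \<le> 1" "0 < r" "0 < \<gamma>" "0 < \<nu>"
    and ae: "a \<simeq> (\<lambda>k. exp (\<nu> * real k powr s))" and be: "b \<simeq> (\<lambda>k. exp (- \<gamma> * real k powr r))"
  shows "\<exists>C\<^sub>1>0. \<exists>C\<^sub>2>0. \<forall>\<sigma>. 0 < \<sigma> \<and> \<sigma> < 1 \<longrightarrow>
          ereal (C\<^sub>1 * exp (- 2 * \<nu> * real (cutoff \<alpha> \<beta> R a b \<sigma>) powr s)) \<le> rate2 \<sigma> \<and>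
          rate2 \<sigma> \<le> ereal (C\<^sub>2 * exp (- 2 * \<nu> * real (cutoff \<alpha> \<beta> R a b \<sigma>) powr s))"
proof -
  obtain A\<^sub>1 A\<^sub>2 where A: "0 < A\<^sub>1" "0 < A\<^sub>2"
    "\<And>k. 1 \<le> k \<Longrightarrow> A\<^sub>1 * exp (- 2 * (\<nu> * real k powr s)) \<le> inverse ((a k)\<^sup>2)"
    "\<And>k. 1 \<le> k \<Longrightarrow> inverse ((a k)\<^sup>2) \<le> A\<^sub>2 * exp (- 2 * (\<nu> * real k powr s))"
    using exponential_weightsE[OF ae] by metis
  obtain B where B: "0 < B" "\<And>k. 1 \<le> k \<Longrightarrow> b k \<le> B * exp (- \<gamma> * real k powr r)"
    using be unfolding same_order_def by blast
  have bdd: "b k \<le> B" if "1 \<le> k" for k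
  proof -
    have "B * exp (- \<gamma> * real k powr r) \<le> B * 1"
      using B pos by (intro mult_left_mono) auto
    then show ?thesis using B(2)[OF that] by simp
  qed
  obtain c\<^sub>2 where c2: "0 < c\<^sub>2"
    "\<And>\<sigma> D p q. \<lbrakk>0 < \<sigma>; \<sigma>\<^sup>2 * noise_level b D \<le> p; inverse ((a (Suc D))\<^sup>2) \<le> q\<rbrakk> \<Longrightarrow> rate2 \<sigma> \<le> ereal (c\<^sub>2 * (p + q))"
    using rate2_upperE by blast
  have c: "0 < c_const \<alpha> \<beta>" by (rule c_const_pos[OF \<beta>(2)])
  define K where "K = R\<^sup>2 / c_const \<alpha> \<beta> + 1"
  have K: "0 < K" using c by (simp add: K_def add_nonneg_pos)
  show ?thesis
  proof (intro exI conjI allI impI)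
    show "0 < R\<^sup>2 * (A\<^sub>1 * exp (- 2 * \<nu>))" "0 < c\<^sub>2 * (K * A\<^sub>2)" using A R c2 K by auto
    fix \<sigma> :: real assume "0 < \<sigma> \<and> \<sigma> < 1"
    then have \<sigma>: "0 < \<sigma>" by auto
    define D where "D = cutoff \<alpha> \<beta> R a b \<sigma>"
    have D: "rho_sq \<alpha> \<beta> b \<sigma> D \<le> R\<^sup>2 * inverse ((a (max 1 D))\<^sup>2)"
      "R\<^sup>2 * inverse ((a (Suc D))\<^sup>2) < rho_sq \<alpha> \<beta> b \<sigma> (Suc D)"
      unfolding D_def using cutoff_bracket[OF \<sigma> bdd] by auto
    have "real (Suc D) powr s \<le> real D powr s + 1"
    proof (cases "D = 0")
      case False
      have "real (Suc D) powr s = real D powr s * (1 + 1 / real D) powr s"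
      proof -
        have "real (Suc D) = real D * (1 + 1 / real D)" using False by (simp add: distrib_left)
        then show ?thesis by (simp only:) (subst powr_mult, auto)
      qed
      also have "\<dots> \<le> real D powr s * (1 + 1 / real D) powr 1"
        using pos by (intro mult_left_mono powr_mono) auto
      also have "\<dots> = real D powr s + real D powr s / real D powr 1" by (simp add: algebra_simps)
      also have "\<dots> \<le> real D powr s + 1"
        using False pos powr_mono[of s 1 "real D"] by (simp add: divide_le_eq)
      finally show ?thesis .
    qed simp
    then have "2 * (\<nu> * real (Suc D) powr s) \<le> 2 * (\<nu> * (real D powr s + 1))"
      using pos by (intro mult_left_mono) auto
    then have De: "exp (- 2 * \<nu>) * exp (- 2 * \<nu> * real D powr s) \<le> exp (- 2 * (\<nu> * real (Suc D) powr s))"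
      by (simp add: mult_exp_exp algebra_simps)
    have "R\<^sup>2 * (A\<^sub>1 * exp (- 2 * \<nu>)) * exp (- 2 * \<nu> * real D powr s)
        \<le> R\<^sup>2 * (A\<^sub>1 * exp (- 2 * (\<nu> * real (Suc D) powr s)))"
      unfolding mult.assoc using De A by (intro mult_left_mono) (auto simp: mult.assoc)
    also have "\<dots> \<le> R\<^sup>2 * inverse ((a (Suc D))\<^sup>2)" by (intro mult_left_mono A(3)) auto
    also have "\<dots> = min (rho_sq \<alpha> \<beta> b \<sigma> (Suc D)) (R\<^sup>2 * inverse ((a (Suc D))\<^sup>2))" using D by simp
    finally have "ereal (R\<^sup>2 * (A\<^sub>1 * exp (- 2 * \<nu>)) * exp (- 2 * \<nu> * real D powr s))
        \<le> ereal (min (rho_sq \<alpha> \<beta> b \<sigma> (Suc D)) (R\<^sup>2 * inverse ((a (Suc D))\<^sup>2)))" by simp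
    also have "\<dots> \<le> rate2 \<sigma>" by (rule minimax_rate_lower[OF \<beta>(2) \<sigma> b a]) simp
    finally show "ereal (R\<^sup>2 * (A\<^sub>1 * exp (- 2 * \<nu>)) * exp (- 2 * \<nu> * real (cutoff \<alpha> \<beta> R a b \<sigma>) powr s)) \<le> rate2 \<sigma>"
      by (simp only: D_def)
    define f where "f = exp (- 2 * \<nu> * real D powr s)"
    have amax: "inverse ((a (max 1 D))\<^sup>2) \<le> A\<^sub>2 * f"
    proof -
      have "real D powr s \<le> real (max 1 D) powr s" using pos by (intro powr_mono2) auto
      then have "exp (- 2 * (\<nu> * real (max 1 D) powr s)) \<le> f" using pos by (simp add: f_def)
      then have "A\<^sub>2 * exp (- 2 * (\<nu> * real (max 1 D) powr s)) \<le> A\<^sub>2 * f" using A by (intro mult_left_mono) auto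
      then show ?thesis using A(4)[of "max 1 D"] by linarith
    qed
    have "rate2 \<sigma> \<le> ereal (c\<^sub>2 * (R\<^sup>2 / c_const \<alpha> \<beta> * (A\<^sub>2 * f) + A\<^sub>2 * f))"
    proof (rule c2(2)[OF \<sigma>])
      have "c_const \<alpha> \<beta> * (\<sigma>\<^sup>2 * noise_level b D) = rho_sq \<alpha> \<beta> b \<sigma> D"
        by (simp add: rho_sq_def noise_level_def)
      also note D(1)
      also have "R\<^sup>2 * inverse ((a (max 1 D))\<^sup>2) \<le> R\<^sup>2 * (A\<^sub>2 * f)" using amax by (intro mult_left_mono) auto
      finally show "\<sigma>\<^sup>2 * noise_level b D \<le> R\<^sup>2 / c_const \<alpha> \<beta> * (A\<^sub>2 * f)"
        using c by (simp add: field_simps)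
      have m: "0 < a (max 1 D)" "a (max 1 D) \<le> a (Suc D)"
        using a by (auto intro: mono_onD[OF a(2)])
      then have "inverse ((a (Suc D))\<^sup>2) \<le> inverse ((a (max 1 D))\<^sup>2)"
        by (intro le_imp_inverse_le power_mono) auto
      then show "inverse ((a (Suc D))\<^sup>2) \<le> A\<^sub>2 * f" using amax by simp
    qed
    then show "rate2 \<sigma> \<le> ereal (c\<^sub>2 * (K * A\<^sub>2) * exp (- 2 * \<nu> * real (cutoff \<alpha> \<beta> R a b \<sigma>) powr s))"
      unfolding D_def[symmetric] f_def[symmetric] K_def by (simp add: algebra_simps)
  qed
qed

end

theorem corollary3:
  fixes \<alpha> \<beta> R s t r \<gamma> \<nu> :: real and a b :: "nat \<Rightarrow> real"
  assumes "0 < \<alpha>" "\<alpha> < 1" and "0 < \<beta>" "\<beta> < 1 - \<alpha>" and "0 < R"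
    and "0 < s" "0 < t" "0 < r" "0 < \<gamma>" "0 < \<nu>"
    and "\<forall>j\<in>J. 0 < b j"
    and "\<forall>k\<in>J. 0 < a k" and "mono_on J a"
  shows
    "(a \<simeq> (\<lambda>k. real k powr s) \<and> b \<simeq> (\<lambda>k. real k powr (- t)) \<longrightarrow>
       (\<exists>C\<^sub>1>0. \<exists>C\<^sub>2>0. \<forall>\<sigma>. 0 < \<sigma> \<and> \<sigma> < 1 \<longrightarrow>
          ereal (C\<^sub>1 * \<sigma> powr (4 * s / (2 * s + 2 * t + 1/2)))
            \<le> (minimax_rate b \<sigma> (ellipsoid a R) \<alpha> \<beta>)\<^sup>2 \<and>
          (minimax_rate b \<sigma> (ellipsoid a R) \<alpha> \<beta>)\<^sup>2
            \<le> ereal (C\<^sub>2 * \<sigma> powr (4 * s / (2 * s + 2 * t + 1/2)))))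
     \<and>
     (a \<simeq> (\<lambda>k. real k powr s) \<and> b \<simeq> (\<lambda>k. exp (- \<gamma> * real k powr r)) \<longrightarrow>
       (\<forall>\<sigma>\<^sub>0. 0 < \<sigma>\<^sub>0 \<and> \<sigma>\<^sub>0 < 1 \<longrightarrow> (\<exists>C\<^sub>1>0. \<forall>\<sigma>. 0 < \<sigma> \<and> \<sigma> \<le> \<sigma>\<^sub>0 \<longrightarrow>
          ereal (C\<^sub>1 * (ln (\<sigma> powr (- 2))) powr (- 2 * s / r))
            \<le> (minimax_rate b \<sigma> (ellipsoid a R) \<alpha> \<beta>)\<^sup>2)) \<and>
       (\<exists>C\<^sub>2>0. \<forall>\<sigma>. 0 < \<sigma> \<and> \<sigma> < 1 \<longrightarrow>
          (minimax_rate b \<sigma> (ellipsoid a R) \<alpha> \<beta>)\<^sup>2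
            \<le> ereal (C\<^sub>2 * (ln (\<sigma> powr (- 2))) powr (- 2 * s / r))))
     \<and>
     (a \<simeq> (\<lambda>k. exp (\<nu> * real k powr s)) \<and> b \<simeq> (\<lambda>k. real k powr (- t)) \<longrightarrow>
       (\<exists>C\<^sub>1>0. \<forall>\<sigma>. 0 < \<sigma> \<and> \<sigma> < 1 \<longrightarrow>
          ereal (C\<^sub>1 * (\<sigma>\<^sup>2 * (ln (\<sigma> powr (- 2))) powr ((2 * t + 1/2) / s)))
            \<le> (minimax_rate b \<sigma> (ellipsoid a R) \<alpha> \<beta>)\<^sup>2) \<and>
       (\<forall>\<sigma>\<^sub>0. 0 < \<sigma>\<^sub>0 \<and> \<sigma>\<^sub>0 < 1 \<longrightarrow> (\<exists>C\<^sub>2>0. \<forall>\<sigma>. 0 < \<sigma> \<and> \<sigma> \<le> \<sigma>\<^sub>0 \<longrightarrow>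
          (minimax_rate b \<sigma> (ellipsoid a R) \<alpha> \<beta>)\<^sup>2
            \<le> ereal (C\<^sub>2 * (\<sigma>\<^sup>2 * (ln (\<sigma> powr (- 2))) powr ((2 * t + 1/2) / s))))))
     \<and>
     (s \<le> 1 \<and> a \<simeq> (\<lambda>k. exp (\<nu> * real k powr s)) \<and> b \<simeq> (\<lambda>k. exp (- \<gamma> * real k powr r)) \<longrightarrow>
       (\<exists>C\<^sub>1>0. \<exists>C\<^sub>2>0. \<forall>\<sigma>. 0 < \<sigma> \<and> \<sigma> < 1 \<longrightarrow>
          ereal (C\<^sub>1 * exp (- 2 * \<nu> * real (cutoff \<alpha> \<beta> R a b \<sigma>) powr s))
            \<le> (minimax_rate b \<sigma> (ellipsoid a R) \<alpha> \<beta>)\<^sup>2 \<and>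
          (minimax_rate b \<sigma> (ellipsoid a R) \<alpha> \<beta>)\<^sup>2
            \<le> ereal (C\<^sub>2 * exp (- 2 * \<nu> * real (cutoff \<alpha> \<beta> R a b \<sigma>) powr s))))"
proof -
  interpret testing_problem \<alpha> \<beta> R a b
    using assms by unfold_locales auto
  note pos = \<open>0 < s\<close> \<open>0 < t\<close> \<open>0 < r\<close> \<open>0 < \<gamma>\<close> \<open>0 < \<nu>\<close>
  show ?thesis
    by (intro conjI impI allI; elim conjE)
       (rule polynomial_polynomial_rate[OF pos(1,2)] polynomial_exponential_lower[OF pos(1,3,4)]
          polynomial_exponential_upper[OF pos(1,3,4)] exponential_polynomial_lower[OF pos(1,2,5)]
          exponential_polynomial_upper[OF pos(1,2,5)] exponential_exponential_rate[OF pos(1) _ pos(3-5)];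
        assumption)+
qed

end
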